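(* For every $k\geq1$, $H_k(\boldsymbol{d})\neq 0$. Writing $H_k(\boldsymbol{d})=\sum_{s\geq \nu_k}\kappa_{k,s}u^s$ with $\kappa_{k,s}\in\mathbb{F}_q[t,\theta]$ and $\kappa_{k,\nu_k}\neq0$, we have: (1) $\nu_k=\frac{(q^k-1)(q^{k-1}-1)}{q^2-1}$; (2) $\kappa_{k,\nu_k}=B_k(t)$; (3) $H_k(\boldsymbol{d})/\kappa_{k,\nu_k}$ lies in $\mathbb{F}_q[t,\theta][[u^{q-1}]]$ and is normalised (its lowest-order nonzero coefficient is $1$).
   Context: Let $q$ be a prime power, $A=\mathbb{F}_q[\theta]$, $K=\mathbb{F}_q(\theta)$. Let $u$ be the usual uniformiser at infinity for Drinfeld modular forms for $\mathbf{GL}_2(A)$, $g\in A[[u]]$ the $u$-expansion of the normalised Eisenstein series of weight $q-1$ and type $0$ ($g=1-(\theta^q-\theta)u^{q-1}+\cdots$), $h\in A[[u]]$ that of the Poincaré series of weight $q+1$, type $1$ ($h=-u-\cdots$), and $\Delta=-h^{q-1}$. Let $t$ be an indeterminate. On $\mathbb{F}_q[t,\theta][[u]]$ let $\tau$ be the $\mathbb{F}_q[t]$-linear continuous endomorphism with $\tau\theta=\theta^q$, $\tau u=u^q$, and $\chi$ the continuous endomorphism fixing $\theta$ and $u$ with $\chi t=t^q$. Let $\boldsymbol{d}\in\mathbb{F}_q[t,\theta][[u]]$ be the unique solution of $(t-\theta^q)\Delta\,\tau^2X+g\,\tau X-X=0$ whose constant term in $u$ is $1$. For a series $f$, $H_k(f)=\det(\chi^{i-1}\tau^{j-1}f)_{1\leq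 i,j\leq k}$. Let $B_k(t)=\prod_{0\leq i<j<k}(t^{q^j}-t^{q^i})\in\mathbb{F}_q[t]$. *)

theory Defs
  imports
    "HOL-Analysis.Infinite_Sum"
    "HOL-Analysis.Elementary_Metric_Spaces"
    "HOL-Computational_Algebra.Computational_Algebra"
    "HOL-Library.Cardinality"
    "Jordan_Normal_Form.Determinant"
begin

section \<open>The analytic setting\<close>

text \<open>
  The field \<open>\<F>\<^sub>q\<close> is an arbitrary type \<open>'f\<close> of class \<^class>\<open>finite_field\<close>, with \<open>q = CARD('f)\<close>,
  and \<open>A = \<F>\<^sub>q[\<theta>]\<close> is the type \<open>'f poly\<close>.
  The field \<open>C\<^sub>\<infinity>\<close> (the completion of an algebraic closure of \<open>K\<^sub>\<infinity> = \<F>\<^sub>q((1/\<theta>))\<close>) is a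
  complete metric field \<open>'c\<close> together with an embedding \<open>emb\<close> of \<open>A\<close>. Its absolute value is
  \<open>|x| = dist x 0\<close>, and \<open>K\<^sub>\<infinity>\<close> is the closure of the image of \<open>K = \<F>\<^sub>q(\<theta>)\<close>.
\<close>

definition K_infinity :: "('f::finite_field poly \<Rightarrow> 'c::{field, metric_space}) \<Rightarrow> 'c set" where
  "K_infinity emb = closure {emb a / emb b | a b. b \<noteq> 0}"

text \<open>
  The absolute value is nonarchimedean and \<open>\<F>\<^sub>q\<close> is finite, so fixing \<open>|\<theta>| = q\<close> makes it restrict
  to \<open>q ^ degree\<close> on \<open>A\<close>. As the field is algebraically closed, the elements algebraic
  over \<open>K\<^sub>\<infinity>\<close> form an algebraic closure of \<open>K\<^sub>\<infinity>\<close>; density of these elements together with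
  completeness determines \<open>C\<^sub>\<infinity>\<close> up to isometric isomorphism.
\<close>

locale C_infinity = comm_ring_hom emb
  for emb :: "'f::finite_field poly \<Rightarrow> 'c::{alg_closed_field, complete_space}" +
  assumes dist_eq_abs_diff: "dist x y = dist (x - y) 0"
    and abs_mult: "dist (x * y) 0 = dist x 0 * dist y (0 :: 'c)"
    and abs_ultrametric: "dist (x + y) 0 \<le> max (dist x 0) (dist y (0 :: 'c))"
    and abs_theta: "dist (emb [:0, 1:]) 0 = real CARD('f)"
    and algebraic_dense:
      "closure {x. \<exists>p. p \<noteq> 0 \<and> (\<forall>i. coeff p i \<in> K_infinity emb) \<and> poly p x = 0} = UNIV"

text \<open>The Drinfeld upper half plane, with imaginary part \<open>|z|\<^sub>i = inf {|z - x| : x \<in> K\<^sub>\<infinity>}\<close>.\<close>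

definition drinfeld_plane :: "('f::finite_field poly \<Rightarrow> 'c::{field, metric_space}) \<Rightarrow> 'c set" where
  "drinfeld_plane emb = - K_infinity emb"

definition imag_abs :: "('f::finite_field poly \<Rightarrow> 'c::{field, metric_space}) \<Rightarrow> 'c \<Rightarrow> real" where
  "imag_abs emb z = infdist z (K_infinity emb)"

definition carlitz_D :: "nat \<Rightarrow> 'f::finite_field poly" where
  "carlitz_D i = (\<Prod>j<i. [:0, 1:] ^ (CARD('f) ^ i) - [:0, 1:] ^ (CARD('f) ^ j))"

definition carlitz_exp ::
    "('f::finite_field poly \<Rightarrow> 'c::{field, metric_space}) \<Rightarrow> 'c \<Rightarrow> 'c" where
  "carlitz_exp emb z = (\<Sum>i. z ^ (CARD('f) ^ i) / emb (carlitz_D i))"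

text \<open>
  A fundamental period generates the kernel of the Carlitz exponential as an \<open>A\<close>-module. It is
  unique up to a factor in \<open>\<F>\<^sub>q\<^sup>\<times>\<close>.
\<close>

definition carlitz_period ::
    "('f::finite_field poly \<Rightarrow> 'c::{field, metric_space}) \<Rightarrow> 'c \<Rightarrow> bool" where
  "carlitz_period emb \<pi> \<longleftrightarrow> {z. carlitz_exp emb z = 0} = range (\<lambda>a. \<pi> * emb a)"

definition uniformiser ::
    "('f::finite_field poly \<Rightarrow> 'c::{field, metric_space}) \<Rightarrow> 'c \<Rightarrow> 'c \<Rightarrow> 'c" where
  "uniformiser emb \<pi> z = 1 / carlitz_exp emb (\<pi> * z)"

definition is_u_expansion ::
    "('f::finite_field poly \<Rightarrow> 'c::{field, metric_space}) \<Rightarrow> 'c \<Rightarrow> 'f poly fps \<Rightarrow> ('c \<Rightarrow> 'c) \<Rightarrow> bool"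
  where
  "is_u_expansion emb \<pi> f F \<longleftrightarrow>
     (\<exists>M. \<forall>z\<in>drinfeld_plane emb. imag_abs emb z > M \<longrightarrow>
        (\<lambda>n. emb (fps_nth f n) * uniformiser emb \<pi> z ^ n) sums F z)"

text \<open>
  For \<open>w\<close> divisible by \<open>q - 1\<close>, the sum over \<open>a = 0\<close>, \<open>b \<noteq> 0\<close> is the constant term of the
  \<open>u\<close>-expansion of the Eisenstein series of weight \<open>w\<close>; normalising means dividing by it.
\<close>

definition eisenstein ::
    "nat \<Rightarrow> ('f::finite_field poly \<Rightarrow> 'c::{field, metric_space}) \<Rightarrow> 'c \<Rightarrow> 'c" where
  "eisenstein w emb z = (\<Sum>\<^sub>\<infinity>(a, b) \<in> - {(0, 0)}. 1 / (emb a * z + emb b) ^ w)"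

definition normalised_eisenstein ::
    "nat \<Rightarrow> ('f::finite_field poly \<Rightarrow> 'c::{field, metric_space}) \<Rightarrow> 'c \<Rightarrow> 'c" where
  "normalised_eisenstein w emb z = eisenstein w emb z / (\<Sum>\<^sub>\<infinity>b \<in> - {0}. 1 / emb b ^ w)"

definition GL2 :: "'f::finite_field poly mat set" where
  "GL2 = {\<gamma> \<in> carrier_mat 2 2. invertible_mat \<gamma>}"

definition GL2_H :: "'f::finite_field poly mat set" where
  "GL2_H = {\<gamma> \<in> GL2. \<gamma> $$ (1, 0) = 0 \<and> \<gamma> $$ (1, 1) = 1}"

definition H_cosets :: "'f::finite_field poly mat set set" where
  "H_cosets = GL2 // {(\<gamma>, \<gamma>'). \<gamma> \<in> GL2 \<and> (\<exists>\<eta>\<in>GL2_H. \<gamma>' = \<eta> * \<gamma>)}"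

definition moebius ::
    "('f::finite_field poly \<Rightarrow> 'c::{field, metric_space}) \<Rightarrow> 'f poly mat \<Rightarrow> 'c \<Rightarrow> 'c" where
  "moebius emb \<gamma> z =
     (emb (\<gamma> $$ (0, 0)) * z + emb (\<gamma> $$ (0, 1))) / (emb (\<gamma> $$ (1, 0)) * z + emb (\<gamma> $$ (1, 1)))"

text \<open>
  Poincare series of weight \<open>w\<close> and type \<open>m\<close>, a sum over \<open>H \ GL\<^sub>2(A)\<close>. The summand is constant
  on each coset because \<open>u (a z + b) = u z / a\<close> for \<open>a \<in> \<F>\<^sub>q\<^sup>\<times>\<close> and \<open>b \<in> A\<close>.
\<close>

definition poincare ::
    "nat \<Rightarrow> nat \<Rightarrow> ('f::finite_field poly \<Rightarrow> 'c::{field, metric_space}) \<Rightarrow> 'c \<Rightarrow> 'c \<Rightarrow> 'c" where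
  "poincare w m emb \<pi> z =
     (\<Sum>\<^sub>\<infinity>X\<in>H_cosets. let \<gamma> = (SOME \<gamma>. \<gamma> \<in> X) in
        emb (det \<gamma>) ^ m * uniformiser emb \<pi> (moebius emb \<gamma> z) ^ m
          / (emb (\<gamma> $$ (1, 0)) * z + emb (\<gamma> $$ (1, 1))) ^ w)"


section \<open>Formal series over \<open>\<F>\<^sub>q[t, \<theta>]\<close>\<close>

text \<open>
  \<open>\<F>\<^sub>q[t, \<theta>] = A[t]\<close> is the type \<open>'f poly poly\<close>: the outer variable is \<open>t\<close>, the inner one \<open>\<theta>\<close>.
\<close>

definition t_var :: "'f::finite_field poly poly" where
  "t_var = [:0, 1:]"

definition theta :: "'f::finite_field poly poly" where
  "theta = [:[:0, 1:]:]"

text \<open>The inclusion of \<open>A[[u]]\<close> in \<open>\<F>\<^sub>q[t, \<theta>][[u]]\<close>.\<close>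

definition lift_series :: "'f::finite_field poly fps \<Rightarrow> 'f poly poly fps" where
  "lift_series f = Abs_fps (\<lambda>n. [:fps_nth f n:])"

text \<open>\<open>\<theta> \<mapsto> \<theta>\<^sup>q\<close> in each coefficient, followed by the substitution \<open>u \<mapsto> u\<^sup>q\<close>.\<close>

definition tau :: "'f::finite_field poly poly fps \<Rightarrow> 'f poly poly fps" where
  "tau f = fps_compose
     (Abs_fps (\<lambda>n. map_poly (\<lambda>a. pcompose a (monom 1 CARD('f))) (fps_nth f n)))
     (fps_X ^ CARD('f))"

text \<open>\<open>t \<mapsto> t\<^sup>q\<close> in each coefficient.\<close>

definition chi :: "'f::finite_field poly poly fps \<Rightarrow> 'f poly poly fps" where
  "chi f = Abs_fps (\<lambda>n. pcompose (fps_nth f n) (monom 1 CARD('f)))"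

definition Delta :: "'f::finite_field poly fps \<Rightarrow> 'f poly fps" where
  "Delta h = - (h ^ (CARD('f) - 1))"

definition H_det :: "nat \<Rightarrow> 'f::finite_field poly poly fps \<Rightarrow> 'f poly poly fps" where
  "H_det k f = det (mat k k (\<lambda>(i, j). (chi ^^ i) ((tau ^^ j) f)))"

definition B_poly :: "nat \<Rightarrow> 'f::finite_field poly poly" where
  "B_poly k = (\<Prod>j<k. \<Prod>i<j. t_var ^ (CARD('f) ^ j) - t_var ^ (CARD('f) ^ i))"

end

theory Submission
  imports Defs
begin

text \<open>
  Write \<open>d = \<Sum> d\<^sub>m t\<^sup>m\<close> with \<open>d\<^sub>m \<in> A[[u]]\<close>. On \<open>A[[u]]\<close> the operator \<open>\<tau>\<close> multiplies orders by \<open>q\<close>, and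
  comparing coefficients of \<open>t\<^sup>m\<close> in the functional equation gives
  \<open>d\<^sub>m = g \<tau> d\<^sub>m + \<Delta> (\<tau>\<^sup>2 d\<^bsub>m-1\<^esub> - \<theta>\<^sup>q \<tau>\<^sup>2 d\<^sub>m)\<close>. Hence \<open>d\<^sub>m\<close> has leading term \<open>(-1)\<^sup>m u ^ e\<^sub>m\<close> with
  \<open>e\<^sub>0 = 0\<close> and \<open>e\<^sub>m = (q - 1) + q\<^sup>2 e\<^bsub>m-1\<^esub>\<close>.

  Row \<open>i\<close> of the matrix defining \<open>H\<^sub>k(d)\<close> is the evaluation of the polynomials \<open>\<tau>\<^sup>j d\<close> in \<open>t\<close> at the node
  \<open>t ^ (q ^ i)\<close>. Newton interpolation at these nodes factors the matrix as a triangular matrix of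
  determinant \<open>B\<^sub>k(t)\<close> times a matrix of divided differences, whose entry \<open>(m, j)\<close> has leading term
  \<open>(-1)\<^sup>m u ^ (e\<^sub>m q\<^sup>j)\<close>. By the rearrangement inequality only the order-reversing permutation contributes to
  the lowest term of the determinant of the latter, which is therefore \<open>u ^ \<nu>\<^sub>k\<close> with
  \<open>\<nu>\<^sub>k = \<Sum> e\<^sub>m q ^ (k - 1 - m)\<close>.

  That only powers of \<open>u ^ (q - 1)\<close> occur is inherited from \<open>g\<close> and \<open>\<Delta>\<close>, where it comes from the
  substitutions \<open>z \<mapsto> c z\<close> with \<open>c \<in> \<F>\<^sub>q\<^sup>\<times>\<close> and the identity theorem for power series in \<open>u\<close>. The latter
  needs points with \<open>u(z) \<noteq> 0\<close> arbitrarily small, hence a lower bound for the Carlitz exponential and the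
  existence of a nonzero period.
\<close>

section \<open>Leading terms and divided differences\<close>

text \<open>The value \<open>c\<close> may be zero. So the predicate reads f = c u^n + O(u^(n+1)),
  it is stable under sums, and a summand of larger order enters with coefficient 0.\<close>

definition lead_at :: "'a::zero fps \<Rightarrow> nat \<Rightarrow> 'a \<Rightarrow> bool" where
  "lead_at f n c \<longleftrightarrow> (\<forall>i<n. fps_nth f i = 0) \<and> fps_nth f n = c"

lemma lead_at_weaken: "lead_at f n c \<Longrightarrow> m < n \<Longrightarrow> lead_at f m 0"
  by (simp add: lead_at_def)

lemma lead_at_mult:
  fixes f g :: "'a::comm_ring_1 fps"
  assumes "lead_at f m a" "lead_at g n b"
  shows "lead_at (f * g) (m + n) (a * b)"
proof -
  \<comment> \<open>Up to degree m + n every convolution term has a factor below its order, except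
    the one with i = m in degree m + n.\<close>
  have zero: "fps_nth f i * fps_nth g (l - i) = 0" if "i \<le> l" "l \<le> m + n" "\<not> (l = m + n \<and> i = m)" for i l
  proof (cases "i < m")
    case True
    then show ?thesis using assms by (simp add: lead_at_def)
  next
    case False
    then have "l - i < n" using that by linarith
    then show ?thesis using assms by (simp add: lead_at_def)
  qed
  have "fps_nth (f * g) (m + n) = (\<Sum>i\<in>{m}. fps_nth f i * fps_nth g (m + n - i))"
    unfolding fps_mult_nth by (rule sum.mono_neutral_right) (auto intro!: zero)
  also have "\<dots> = a * b" using assms by (simp add: lead_at_def)
  finally have "fps_nth (f * g) (m + n) = a * b" .
  moreover have "fps_nth (f * g) l = 0" if "l < m + n" for l
    unfolding fps_mult_nth by (intro sum.neutral ballI zero) (use that in auto)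
  ultimately show ?thesis by (simp add: lead_at_def)
qed

lemma lead_at_const: "lead_at (fps_const c) 0 c"
  by (simp add: lead_at_def)

lemma lead_at_power:
  fixes f :: "'a::comm_ring_1 fps"
  assumes "lead_at f m a"
  shows "lead_at (f ^ n) (n * m) (a ^ n)"
proof (induction n)
  case 0
  then show ?case using lead_at_const[of "1::'a"] by simp
next
  case (Suc n)
  then show ?case using lead_at_mult[OF assms Suc] by simp
qed

lemma lead_at_uminus: "lead_at (f :: 'a::ring_1 fps) m a \<Longrightarrow> lead_at (- f) m (- a)"
  by (simp add: lead_at_def)

lemma lead_at_sum:
  fixes f :: "'b \<Rightarrow> 'a::ring_1 fps"
  assumes "\<And>i. i \<in> I \<Longrightarrow> lead_at (f i) n (c i)"
  shows "lead_at (sum f I) n (sum c I)"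
  using assms by (auto simp: lead_at_def fps_sum_nth intro: sum.neutral)

lemma minus_one_power_fps: "(- 1 :: 'a::comm_ring_1 fps) ^ n = fps_const ((- 1) ^ n)"
  by (simp flip: fps_const_power fps_const_neg)

text \<open>The increasing enumeration of the naturals other than \<open>j\<close>. It turns column
  indices of the minor without column \<open>j\<close> into those of the full matrix.\<close>

definition skip :: "nat \<Rightarrow> nat \<Rightarrow> nat" where
  "skip j l = (if l < j then l else Suc l)"

lemma strict_mono_skip: "strict_mono (skip j)"
  by (auto simp: strict_mono_def skip_def)

text \<open>Strict rearrangement inequality: deleting column \<open>j\<close> rather than column 0 against the
  heaviest row \<open>k\<close> costs weight.\<close>

lemma rearrangement_skip:
  fixes e w :: "nat \<Rightarrow> nat"
  assumes e: "strict_mono e" and w: "strict_mono w" and "0 < j" "j \<le> k"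
  shows "e k * w 0 + (\<Sum>m<k. e m * w (k - m)) < e k * w j + (\<Sum>m<k. e m * w (skip j (k - 1 - m)))"
proof -
  define F where "F j = e k * w j + (\<Sum>m<k. e m * w (skip j (k - 1 - m)))" for j
  have step: "F j < F (Suc j)" if "Suc j \<le> k" for j
  proof -
    \<comment> \<open>From \<open>j\<close> to \<open>Suc j\<close> only two rows exchange columns:
      row \<open>k\<close> gives up \<open>j\<close> for \<open>Suc j\<close>, and row
      \<open>r\<close> does the opposite. As e r < e k, the weight grows.\<close>
    define r where "r = k - 1 - j"
    have r: "r < k" "k - 1 - r = j" using that by (auto simp: r_def)
    have same: "(\<Sum>m\<in>{..<k}-{r}. e m * w (skip (Suc j) (k - 1 - m)))
        = (\<Sum>m\<in>{..<k}-{r}. e m * w (skip j (k - 1 - m)))"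
      by (rule sum.cong) (use r in \<open>auto simp: skip_def less_Suc_eq\<close>)
    have S: "(\<Sum>m<k. e m * w (skip i (k - 1 - m)))
        = e r * w (skip i j) + (\<Sum>m\<in>{..<k}-{r}. e m * w (skip i (k - 1 - m)))" for i
      using r by (subst sum.remove[of _ r]) auto
    obtain a where a: "w (Suc j) = w j + a" "0 < a"
      using w by (metis lessI less_imp_add_positive strict_mono_def)
    have er: "e r < e k" using e r by (simp add: strict_mono_def)
    show ?thesis
      unfolding F_def S same using a er
      by (simp add: skip_def algebra_simps)
  qed
  have "F 0 < F j" using \<open>0 < j\<close> \<open>j \<le> k\<close>
  proof (induction j rule: nat_induct_non_zero)
    case 1
    then show ?case using step[of 0] by simp
  next
    case (Suc n)
    then show ?case using step[of n] by simp
  qed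
  moreover have "F 0 = e k * w 0 + (\<Sum>m<k. e m * w (k - m))"
    unfolding F_def by (intro arg_cong2[of _ _ _ _ "(+)"] sum.cong refl) (auto simp: skip_def Suc_diff_Suc)
  ultimately show ?thesis by (simp add: F_def)
qed

text \<open>The signs \<open>(-1) ^ m\<close> cancel the signature of the order-reversing permutation.\<close>

lemma lead_at_det:
  fixes M :: "nat \<Rightarrow> nat \<Rightarrow> 'a::comm_ring_1 fps" and e w :: "nat \<Rightarrow> nat"
  assumes e: "strict_mono e" and w: "strict_mono w"
    and M: "\<And>m j. lead_at (M m j) (e m * w j) ((- 1) ^ m)"
  shows "lead_at (det (mat k k (\<lambda>(m, j). M m j))) (\<Sum>m<k. e m * w (k - 1 - m)) 1"
  using w M
proof (induction k arbitrary: w M)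
  case 0
  then show ?case using lead_at_const[of "1::'a"] by (simp add: det_dim_zero)
next
  case (Suc k)
  let ?A = "mat (Suc k) (Suc k) (\<lambda>(m, j). M m j)"
  let ?D = "\<lambda>j. det (mat k k (\<lambda>(m, l). M m (skip j l)))"
  let ?S = "\<lambda>j. \<Sum>m<k. e m * w (skip j (k - 1 - m))"
  let ?N = "\<Sum>m<Suc k. e m * w (Suc k - 1 - m)"
  \<comment> \<open>A minor has the same shape with weights \<open>w \<circ> skip j\<close>, again
    strictly increasing; hence \<open>w\<close> and \<open>M\<close> are general in the
    induction.\<close>
  have D: "lead_at (?D j) (?S j) 1" for j
    using Suc.prems strict_mono_skip[of j]
    by (intro Suc.IH[of "w \<circ> skip j" "\<lambda>m l. M m (skip j l)", unfolded o_def])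
      (auto simp: strict_mono_def)
  have minor: "mat_delete ?A k j = mat k k (\<lambda>(m, l). M m (skip j l))" if "j < Suc k" for j
    by (rule eq_matI) (auto simp: mat_delete_def skip_def)
  have N0: "?N = e k * w 0 + (\<Sum>m<k. e m * w (k - m))" by simp
  \<comment> \<open>Laplace expansion along the heaviest row. Only column 0 attains order
    \<open>?N\<close>, and there the sign of the entry cancels that of the cofactor; all other
    columns start at a larger order.\<close>
  have expand: "lead_at (?A $$ (k, j) * cofactor ?A k j) ?N (if j = 0 then 1 else 0)"
    if j: "j < Suc k" for j
  proof -
    have "lead_at (M k j * (fps_const ((- 1) ^ (k + j)) * ?D j)) (e k * w j + (0 + ?S j))
        ((- 1) ^ k * ((- 1) ^ (k + j) * 1))"
      by (intro lead_at_mult Suc.prems D lead_at_const)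
    moreover have "?A $$ (k, j) * cofactor ?A k j = M k j * (fps_const ((- 1) ^ (k + j)) * ?D j)"
      using j by (simp add: cofactor_def minor minus_one_power_fps)
    ultimately have L: "lead_at (?A $$ (k, j) * cofactor ?A k j) (e k * w j + ?S j)
        ((- 1) ^ k * (- 1) ^ (k + j))"
      by simp
    show ?thesis
    proof (cases "j = 0")
      case True
      have "e k * w 0 + ?S 0 = ?N"
        unfolding N0 by (intro arg_cong2[of _ _ _ _ "(+)"] sum.cong refl) (auto simp: skip_def Suc_diff_Suc)
      with L True show ?thesis by (simp only: add_0_right minus_one_mult_self simp_thms if_True)
    next
      case False
      then have "?N < e k * w j + ?S j"
        unfolding N0 using rearrangement_skip[OF e Suc.prems(1)] j by simp
      with L False show ?thesis using lead_at_weaken by auto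
    qed
  qed
  have "det ?A = (\<Sum>j<Suc k. ?A $$ (k, j) * cofactor ?A k j)"
    by (rule laplace_expansion_row) auto
  moreover have "lead_at \<dots> ?N (\<Sum>j<Suc k. if j = 0 then 1 else 0)"
    by (rule lead_at_sum) (use expand in auto)
  moreover have "(\<Sum>j<Suc k. if j = 0 then 1 else 0) = (1 :: 'a)"
    by (subst sum.delta) auto
  ultimately show ?case by (simp only:)
qed

text \<open>\<open>complete_hom x m l\<close> is the divided difference of \<open>X ^ l\<close> at the nodes \<open>x 0, \<dots>, x m\<close>, that is,
  the complete homogeneous symmetric polynomial of degree \<open>l - m\<close> in these nodes.\<close>

fun complete_hom :: "(nat \<Rightarrow> 'a::comm_ring_1) \<Rightarrow> nat \<Rightarrow> nat \<Rightarrow> 'a" where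
  "complete_hom x 0 l = x 0 ^ l"
| "complete_hom x (Suc m) 0 = 0"
| "complete_hom x (Suc m) (Suc l) = x (Suc m) * complete_hom x (Suc m) l + complete_hom x m l"

lemma complete_hom_less: "l < m \<Longrightarrow> complete_hom x m l = 0"
  by (induction x m l rule: complete_hom.induct) auto

lemma complete_hom_same: "complete_hom x m m = 1"
  by (induction m) (auto simp: complete_hom_less)

text \<open>Induction on \<open>l\<close> with x_i = x_m + (x_i - x_m): the two summands match the
  two terms in the recursion of \<open>complete_hom\<close>, the second one lengthening the Newton
  product by a factor.\<close>

lemma newton_interpolation_power:
  assumes "i < k"
  shows "x i ^ l = (\<Sum>m<k. (\<Prod>s<m. x i - x s) * complete_hom x m l)"
proof (induction l)
  case 0
  have "(\<Sum>m<k. (\<Prod>s<m. x i - x s) * complete_hom x m 0)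
      = (\<Sum>m\<in>{0}. (\<Prod>s<m. x i - x s) * complete_hom x m 0)"
    by (rule sum.mono_neutral_right) (use assms in \<open>auto simp: complete_hom_less\<close>)
  then show ?case by simp
next
  case (Suc l)
  let ?N = "\<lambda>m. \<Prod>s<m. x i - x s"
  obtain k' where k: "k = Suc k'" using assms by (cases k) auto
  \<comment> \<open>The full product contains the vanishing factor s = i, so the shifted sum below
    may run up to \<open>k\<close> again.\<close>
  have N: "?N k = 0" using assms by (intro prod_zero) auto
  have step: "?N m * complete_hom x m (Suc l)
      = ?N m * x m * complete_hom x m l + (if m = 0 then 0 else ?N m * complete_hom x (m - 1) l)" for m
    by (cases m) (auto simp: algebra_simps)
  have "(\<Sum>m<k. if m = 0 then 0 else ?N m * complete_hom x (m - 1) l)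
      = (\<Sum>m<k'. ?N (Suc m) * complete_hom x m l)"
    unfolding k by (subst sum.lessThan_Suc_shift) simp
  also have "\<dots> = (\<Sum>m<k. ?N (Suc m) * complete_hom x m l)"
    using N by (simp add: k del: prod.lessThan_Suc)
  finally have "(\<Sum>m<k. ?N m * complete_hom x m (Suc l))
      = (\<Sum>m<k. ?N m * x m * complete_hom x m l) + (\<Sum>m<k. ?N (Suc m) * complete_hom x m l)"
    by (simp only: step sum.distrib)
  also have "\<dots> = (\<Sum>m<k. x i * (?N m * complete_hom x m l))"
    by (simp add: sum.distrib[symmetric] algebra_simps)
  also have "\<dots> = x i ^ Suc l"
    by (simp add: Suc[symmetric] flip: sum_distrib_left)
  finally show ?case by simp
qed

text \<open>Linear extension of \<open>complete_hom\<close> from powers to polynomials. Without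
  quotients it makes sense over any commutative ring, whether or not differences of nodes are
  invertible.\<close>

definition divided_diff :: "(nat \<Rightarrow> 'a::comm_ring_1) \<Rightarrow> nat \<Rightarrow> 'a poly \<Rightarrow> 'a" where
  "divided_diff x m P = (\<Sum>l\<le>degree P. coeff P l * complete_hom x m l)"

lemma divided_diff_0 [simp]: "divided_diff x m 0 = 0"
  by (simp add: divided_diff_def)

lemma newton_interpolation:
  assumes "i < k"
  shows "poly P (x i) = (\<Sum>m<k. (\<Prod>s<m. x i - x s) * divided_diff x m P)"
proof -
  have "poly P (x i) = (\<Sum>l\<le>degree P. coeff P l * (\<Sum>m<k. (\<Prod>s<m. x i - x s) * complete_hom x m l))"
    unfolding poly_altdef newton_interpolation_power[OF assms] ..
  also have "\<dots> = (\<Sum>m<k. (\<Prod>s<m. x i - x s) * divided_diff x m P)"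
    unfolding divided_diff_def sum_distrib_left
    by (subst sum.swap) (simp add: mult_ac)
  finally show ?thesis .
qed

text \<open>\<open>complete_hom\<close> removes the powers below \<open>m\<close> and is 1 at
  \<open>m\<close>, the hypothesis removes those above, so the nodes drop out.\<close>

lemma divided_diff_low:
  assumes "\<And>l. l > m \<Longrightarrow> coeff P l = 0"
  shows "divided_diff x m P = coeff P m"
proof -
  have "divided_diff x m P = (\<Sum>l\<in>{..degree P} \<inter> {m}. coeff P l * complete_hom x m l)"
    unfolding divided_diff_def
  proof (rule sum.mono_neutral_right)
    show "\<forall>i\<in>{..degree P} - {..degree P} \<inter> {m}. coeff P i * complete_hom x m i = 0"
    proof
      fix i assume "i \<in> {..degree P} - {..degree P} \<inter> {m}"
      then have "i < m \<or> m < i" by auto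
      then show "coeff P i * complete_hom x m i = 0"
        using assms complete_hom_less[of i m x] by auto
    qed
  qed auto
  then show ?thesis
    by (cases "m \<le> degree P") (auto simp: complete_hom_same coeff_eq_0)
qed

section \<open>Series in a fixed power of the variable\<close>

definition sparse :: "nat \<Rightarrow> 'a::zero fps \<Rightarrow> bool" where
  "sparse p f \<longleftrightarrow> (\<forall>n. \<not> p dvd n \<longrightarrow> fps_nth f n = 0)"

lemma sparse_mult:
  fixes f g :: "'a::comm_ring_1 fps"
  assumes "sparse p f" "sparse p g"
  shows "sparse p (f * g)"
  unfolding sparse_def
proof (intro allI impI)
  fix n assume n: "\<not> p dvd n"
  have "fps_nth f i * fps_nth g (n - i) = 0" if "i \<le> n" for i
  proof (cases "p dvd i")
    case True
    then have "\<not> p dvd (n - i)" using n that dvd_diffD by blast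
    then show ?thesis using assms(2) by (simp add: sparse_def)
  qed (use assms(1) in \<open>simp add: sparse_def\<close>)
  then show "fps_nth (f * g) n = 0" unfolding fps_mult_nth by (intro sum.neutral) auto
qed

lemma sparse_const: "sparse p (fps_const c)"
  by (auto simp: sparse_def)

lemma sparse_uminus: "sparse p (f :: 'a::comm_ring_1 fps) \<Longrightarrow> sparse p (- f)"
  by (simp add: sparse_def)

lemma sparse_sum: "(\<And>i. i \<in> I \<Longrightarrow> sparse p (f i :: 'a::comm_ring_1 fps)) \<Longrightarrow> sparse p (sum f I)"
  by (auto simp: sparse_def fps_sum_nth)

lemma sparse_prod: "(\<And>i. i \<in> I \<Longrightarrow> sparse p (f i :: 'a::comm_ring_1 fps)) \<Longrightarrow> sparse p (prod f I)"
  by (induction I rule: infinite_finite_induct) (auto intro: sparse_mult sparse_const[of p 1, simplified])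

lemma sparse_power: "sparse p (f :: 'a::comm_ring_1 fps) \<Longrightarrow> sparse p (f ^ n)"
  using sparse_prod[of "{..<n}" p "\<lambda>_. f"] by simp

lemma sparse_det:
  fixes M :: "nat \<Rightarrow> nat \<Rightarrow> 'a::comm_ring_1 fps"
  assumes "\<And>i j. sparse p (M i j)"
  shows "sparse p (det (mat k k (\<lambda>(i, j). M i j)))"
proof -
  have M': "sparse p (mat k k (\<lambda>(i, j). M i j) $$ (i, \<sigma> i))"
    if "\<sigma> permutes {0..<k}" "i < k" for \<sigma> i
    using permutes_in_image[OF that(1), of i] that(2) assms by simp
  have "sparse p (signof \<sigma>  :: 'a fps)" for \<sigma> :: "nat \<Rightarrow> nat"
    using sparse_const[of p "1::'a"] sparse_uminus[OF sparse_const[of p "1::'a"]] by (simp add: sign_def)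
  then show ?thesis
    using M' by (subst det_def') (auto intro!: sparse_sum sparse_mult sparse_prod)
qed

lemma sparse_imp_compose:
  fixes f :: "'a::comm_ring_1 fps"
  assumes "sparse p f" "p > 0"
  shows "f \<in> range (\<lambda>G. fps_compose G (fps_X ^ p))"
proof
  show "f = fps_compose (Abs_fps (\<lambda>n. fps_nth f (n * p))) (fps_X ^ p)"
    using assms by (intro fps_ext) (auto simp: fps_nth_compose_X_power sparse_def)
qed simp

section \<open>The functional equation\<close>

definition frob :: "'f::finite_field poly \<Rightarrow> 'f poly" where
  "frob a = pcompose a (monom 1 CARD('f))"

text \<open>The restriction of \<open>tau\<close> to A[[u]]. Since \<open>tau\<close> fixes t, it
  acts through this map on the coefficient series of each t^m.\<close>

definition frob_fps :: "'f::finite_field poly fps \<Rightarrow> 'f poly fps" where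
  "frob_fps f = Abs_fps (\<lambda>n. if CARD('f) dvd n then frob (fps_nth f (n div CARD('f))) else 0)"

definition t_coeff :: "nat \<Rightarrow> 'f::finite_field poly poly fps \<Rightarrow> 'f poly fps" where
  "t_coeff m f = Abs_fps (\<lambda>n. coeff (fps_nth f n) m)"

lemma card_ge_2: "CARD('f::finite_field) \<ge> 2"
proof -
  have "card {0, 1 :: 'f} \<le> CARD('f)" by (rule card_mono) auto
  then show ?thesis by simp
qed

lemma frob_0 [simp]: "frob 0 = 0"
  by (simp add: frob_def)

lemma frob_minus_one_power: "frob ((- 1) ^ n) = (- 1) ^ n"
  by (cases "even n") (simp_all add: frob_def pcompose_uminus pcompose_1)

lemma fps_nth_tau:
  "fps_nth (tau f) n = (if CARD('f) dvd n then map_poly frob (fps_nth f (n div CARD('f))) else 0)"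
  for f :: "'f::finite_field poly poly fps"
  by (simp add: tau_def fps_nth_compose_X_power frob_def[abs_def])

lemma t_coeff_tau: "t_coeff m (tau f) = frob_fps (t_coeff m f)"
  by (rule fps_ext) (simp add: t_coeff_def frob_fps_def fps_nth_tau coeff_map_poly)

lemma t_coeff_add: "t_coeff m (f + g) = t_coeff m f + t_coeff m g"
  by (rule fps_ext) (simp add: t_coeff_def)

lemma t_coeff_lift_mult: "t_coeff m (lift_series g * f) = g * t_coeff m f"
  by (rule fps_ext) (simp add: t_coeff_def lift_series_def fps_mult_nth coeff_sum)

lemma t_coeff_t_minus_const_mult:
  "t_coeff m (fps_const (t_var - [:c:]) * f) = (if m = 0 then 0 else t_coeff (m - 1) f) - fps_const c * t_coeff m f"
  by (rule fps_ext) (auto simp: t_coeff_def t_var_def algebra_simps coeff_pCons split: nat.splits)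

lemma theta_power: "theta ^ n = [:[:0, 1:] ^ n:]"
  by (induction n) (simp_all add: theta_def)

lemma lead_at_frob_fps:
  assumes "lead_at f n c"
  shows "lead_at (frob_fps f :: 'f::finite_field poly fps) (CARD('f) * n) (frob c)"
  using assms zero_less_card_finite[where ?'a = 'f]
  by (auto simp: lead_at_def frob_fps_def elim!: dvdE)

text \<open>Coefficient i of \<open>frob_fps z\<close> comes from coefficient i div q of
  \<open>z\<close>, which lies below i unless i = 0. As \<open>x\<close> has no constant term, the
  two Frobenius terms cannot contribute before \<open>x\<close> itself has started, so
  \<open>x\<close> starts like \<open>y\<close>.\<close>

lemma lead_at_fixed_point:
  fixes x y g k :: "'f::finite_field poly fps"
  assumes x: "x = y + g * frob_fps x + k * frob_fps (frob_fps x)"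
    and x0: "fps_nth x 0 = 0" and y: "lead_at y n c"
  shows "lead_at x n c"
proof -
  have frob_nth: "fps_nth (frob_fps z) i = 0"
    if "\<And>j. j < l \<or> j = 0 \<Longrightarrow> fps_nth z j = 0" "i \<le> l" for z :: "'f poly fps" and i l
  proof -
    have "i div CARD('f) < l \<or> i div CARD('f) = 0"
      using card_ge_2[where ?'f = 'f] that(2) by (cases "i = 0") (auto intro: less_le_trans[OF div_less_dividend])
    then show ?thesis using that(1) by (auto simp: frob_fps_def)
  qed
  have step: "fps_nth x i = fps_nth y i" if "\<And>j. j < i \<Longrightarrow> fps_nth x j = 0" for i
  proof -
    have a: "fps_nth (frob_fps x) j = 0" if "j \<le> i" for j
      using frob_nth[of i x j] \<open>\<And>j. j < i \<Longrightarrow> fps_nth x j = 0\<close> x0 that by auto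
    have b: "fps_nth (frob_fps (frob_fps x)) j = 0" if "j \<le> i" for j
      by (rule frob_nth[of i]) (use a that in auto)
    show ?thesis
      by (subst x) (simp add: fps_mult_nth a b)
  qed
  have "fps_nth x i = 0" if "i < n" for i
    using that
  proof (induction i rule: less_induct)
    case (less i)
    then show ?case using step[of i] y by (simp add: lead_at_def)
  qed
  then show ?thesis using step[of n] y by (simp add: lead_at_def)
qed

text \<open>The exponents e_m of the opening text; in closed form (q^(2m) - 1) / (q + 1).\<close>

fun t_order :: "nat \<Rightarrow> nat \<Rightarrow> nat" where
  "t_order q 0 = 0"
| "t_order q (Suc m) = (q - 1) + q ^ 2 * t_order q m"

lemma strict_mono_t_order:
  assumes "q \<ge> 2"
  shows "strict_mono (t_order q)"
  unfolding strict_mono_Suc_iff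
proof
  fix m
  have "t_order q m \<le> q\<^sup>2 * t_order q m" using assms by simp
  moreover have "0 < q - 1" using assms by simp
  ultimately show "t_order q m < t_order q (Suc m)" by (simp only: t_order.simps)
qed

text \<open>Induction on \<open>k\<close>: every old term gains a factor q, and the new term is e_k,
  known in closed form.\<close>

lemma sum_t_order:
  assumes "q \<ge> 2" "k \<ge> 1"
  shows "(of_nat (\<Sum>m<k. t_order q m * q ^ (k - 1 - m)) :: rat)
    = (of_nat q ^ k - 1) * (of_nat q ^ (k - 1) - 1) / (of_nat q ^ 2 - 1)"
  using assms(2)
proof (induction k rule: nat_induct_at_least)
  case base
  then show ?case by simp
next
  case (Suc k)
  define Q :: rat where "Q = of_nat q"
  have Q: "Q \<ge> 2" using assms(1) by (simp add: Q_def)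
  have Q2: "Q\<^sup>2 - 1 = (Q - 1) * (Q + 1)" by (simp add: power2_eq_square algebra_simps)
  have ord: "of_nat (t_order q m) * (Q + 1) = Q ^ (2 * m) - 1" for m
  proof (induction m)
    case (Suc m)
    have "of_nat (t_order q (Suc m)) * (Q + 1)
        = (Q - 1) * (Q + 1) + Q\<^sup>2 * (of_nat (t_order q m) * (Q + 1))"
      using assms(1) by (simp add: Q_def of_nat_diff algebra_simps)
    then show ?case unfolding Suc by (simp add: algebra_simps power2_eq_square)
  qed simp
  obtain l where l: "k = Suc l" using Suc.hyps by (cases k) auto
  have "(\<Sum>m<Suc k. t_order q m * q ^ (Suc k - 1 - m))
      = q * (\<Sum>m<k. t_order q m * q ^ (k - 1 - m)) + t_order q k"
  proof -
    have "q ^ (k - m) = q * q ^ (k - 1 - m)" if "m < k" for m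
      using that by (simp flip: power_Suc add: Suc_diff_Suc)
    then have "(\<Sum>m<k. t_order q m * q ^ (k - m)) = (\<Sum>m<k. q * (t_order q m * q ^ (k - 1 - m)))"
      by (intro sum.cong) (auto simp: mult_ac)
    then show ?thesis by (simp add: sum_distrib_left)
  qed
  then have "(of_nat (\<Sum>m<Suc k. t_order q m * q ^ (Suc k - 1 - m)) :: rat)
      = Q * ((Q ^ k - 1) * (Q ^ (k - 1) - 1) / (Q\<^sup>2 - 1)) + of_nat (t_order q k)"
    using Suc.IH by (simp only: of_nat_add of_nat_mult Q_def)
  also have "of_nat (t_order q k) = (Q ^ (2 * k) - 1) / (Q + 1)"
    using ord[of k] Q by (simp add: field_simps)
  also have "Q * ((Q ^ k - 1) * (Q ^ (k - 1) - 1) / (Q\<^sup>2 - 1)) + (Q ^ (2 * k) - 1) / (Q + 1)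
      = (Q ^ Suc k - 1) * (Q ^ (Suc k - 1) - 1) / (Q\<^sup>2 - 1)"
  proof -
    \<comment> \<open>With a = q^(k-1) the claim becomes a polynomial identity in q and a.\<close>
    define a where "a = Q ^ l"
    have a: "Q ^ k = Q * a" "Q ^ (k - 1) = a" "Q ^ Suc k = Q * (Q * a)" "Q ^ (Suc k - 1) = Q * a"
      "Q ^ (2 * k) = Q * a * (Q * a)"
      by (simp_all add: l a_def mult_2 mult_2_right power_add mult_ac)
    have "(Q * a * (Q * a) - 1) / (Q + 1) = (Q * a * (Q * a) - 1) * (Q - 1) / (Q\<^sup>2 - 1)"
      unfolding Q2 using Q by simp
    moreover have "Q * ((Q * a - 1) * (a - 1)) + (Q * a * (Q * a) - 1) * (Q - 1) = (Q * (Q * a) - 1) * (Q * a - 1)"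
      by (simp add: algebra_simps)
    ultimately show ?thesis
      unfolding a times_divide_eq_right by (simp only: add_divide_distrib[symmetric])
  qed
  finally show ?case by (simp add: Q_def)
qed

lemma const_minus_one_power: "[:(- 1) ^ n:] = (- 1 :: 'a::comm_ring_1 poly) ^ n"
proof (induction n)
  case (Suc n)
  have "[:(- 1) ^ Suc n:] = - [:(- 1 :: 'a) ^ n:]" by simp
  then show ?case by (simp only: Suc) simp
qed (simp add: one_pCons)

lemma pcompose_power: "pcompose (p ^ n) r = pcompose p r ^ n" for p :: "'a::comm_semiring_1 poly"
  by (induction n) (simp_all add: pcompose_mult pcompose_1)

text \<open>The power contributes (-1)^(q-1), which is 1 for even and odd q alike because (-1)^q =
  -1 in the field with q elements; only the outer sign survives.\<close>

lemma lead_at_Delta: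
  fixes h :: "'f::finite_field poly fps"
  assumes "fps_nth h 0 = 0" "fps_nth h 1 = - 1"
  shows "lead_at (Delta h) (CARD('f) - 1) (- 1)"
proof -
  have "(- 1 :: 'f) * (- 1) ^ (CARD('f) - 1) = - 1"
    using finite_field_power_card_eq_same[of "- 1 :: 'f"] card_ge_2[where ?'f = 'f]
    by (metis One_nat_def Suc_le_D diff_Suc_1 numeral_2_eq_2 power_Suc)
  then have "(- 1 :: 'f) ^ (CARD('f) - 1) = 1" by simp
  then have one: "(- 1 :: 'f poly) ^ (CARD('f) - 1) = 1"
    using const_minus_one_power[of "CARD('f) - 1", where ?'a = 'f]
    by (metis pCons_one)
  have "lead_at h 1 (- 1)" using assms by (simp add: lead_at_def)
  from lead_at_uminus[OF lead_at_power[OF this, of "CARD('f) - 1"]]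
  show ?thesis by (simp only: Delta_def one mult_1_right)
qed

section \<open>The solution of the functional equation and its determinant\<close>

locale tau_equation =
  fixes q :: nat and g h :: "'f::finite_field poly fps" and d :: "'f poly poly fps"
  assumes q_def: "q = CARD('f)"
    and h_leading: "fps_nth h 0 = 0" "fps_nth h 1 = - 1"
    and d_equation:
      "fps_const (t_var - theta ^ q) * lift_series (Delta h) * tau (tau d)
         + lift_series g * tau d - d = 0"
    and d_constant: "fps_nth d 0 = 1"
begin

lemma q_ge_2: "q \<ge> 2"
  using card_ge_2[where ?'f = 'f] by (simp add: q_def)

lemma d_eq: "d = lift_series (Delta h) * (fps_const (t_var - theta ^ q) * tau (tau d)) + lift_series g * tau d"
  using d_equation by (simp add: algebra_simps)

lemma t_coeff_d:
  "t_coeff m d = Delta h * (if m = 0 then 0 else frob_fps (frob_fps (t_coeff (m - 1) d)))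
     + g * frob_fps (t_coeff m d)
     + (- Delta h * fps_const ([:0, 1:] ^ q)) * frob_fps (frob_fps (t_coeff m d))"
  by (subst d_eq, simp only: t_coeff_add t_coeff_lift_mult theta_power t_coeff_t_minus_const_mult
      t_coeff_tau) (simp add: algebra_simps)

lemma lead_at_t_coeff: "lead_at (t_coeff m d) (t_order q m) ((- 1) ^ m)"
proof (induction m)
  case 0
  then show ?case by (simp add: lead_at_def t_coeff_def d_constant)
next
  case (Suc m)
  have "lead_at (Delta h * frob_fps (frob_fps (t_coeff m d)))
     ((q - 1) + q * (q * t_order q m)) (- 1 * frob (frob ((- 1) ^ m)))"
    by (intro lead_at_mult lead_at_Delta[where ?'f = 'f, folded q_def] lead_at_frob_fps[where ?'f = 'f, folded q_def] Suc h_leading)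
  then have "lead_at (Delta h * frob_fps (frob_fps (t_coeff m d))) (t_order q (Suc m)) ((- 1) ^ Suc m)"
    by (simp add: frob_minus_one_power power2_eq_square mult.assoc)
  \<comment> \<open>The constant term 1 of \<open>d\<close> contains no positive power of t, which
    is the condition of \<open>lead_at_fixed_point\<close>.\<close>
  moreover have "fps_nth (t_coeff (Suc m) d) 0 = 0"
    by (simp add: t_coeff_def d_constant)
  moreover have "t_coeff (Suc m) d = Delta h * frob_fps (frob_fps (t_coeff m d))
      + g * frob_fps (t_coeff (Suc m) d)
      + (- Delta h * fps_const ([:0, 1:] ^ q)) * frob_fps (frob_fps (t_coeff (Suc m) d))"
    using t_coeff_d[of "Suc m"] by (simp only: nat.simps if_False diff_Suc_1)
  ultimately show ?case by (metis lead_at_fixed_point)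
qed

lemma lead_at_t_coeff_tau:
  "lead_at (t_coeff m ((tau ^^ j) d)) (t_order q m * q ^ j) ((- 1) ^ m)"
proof (induction j)
  case (Suc j)
  from lead_at_frob_fps[OF this, folded q_def] show ?case
    by (simp add: t_coeff_tau frob_minus_one_power mult_ac)
qed (use lead_at_t_coeff in auto)

definition node :: "nat \<Rightarrow> 'f poly poly" where
  "node i = t_var ^ (q ^ i)"

text \<open>The coefficients in A are made constants of A[t], so that they and the nodes, which are
  powers of t, lie in one ring.\<close>

definition newton_coeff :: "nat \<Rightarrow> nat \<Rightarrow> 'f poly poly fps" where
  "newton_coeff m j = Abs_fps (\<lambda>n. divided_diff node m (map_poly (\<lambda>a. [:a:]) (fps_nth ((tau ^^ j) d) n)))"

lemma fps_nth_chi_power: "fps_nth ((chi ^^ i) f) n = pcompose (fps_nth f n) (node i)"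
proof (induction i)
  case (Suc i)
  have "pcompose (pcompose p (node i)) (monom 1 q) = pcompose p (node (Suc i))" for p
  proof -
    have "pcompose (node i) (monom 1 q) = node (Suc i)"
      by (simp add: node_def t_var_def pcompose_power pcompose_pCons power_mult monom_altdef mult.commute)
    then show ?thesis by (simp flip: pcompose_assoc)
  qed
  with Suc show ?case by (simp add: chi_def[where ?'f = 'f, folded q_def])
qed (simp add: node_def t_var_def)

lemma chi_tau_newton:
  assumes "i < k"
  shows "(chi ^^ i) ((tau ^^ j) d) = (\<Sum>m<k. fps_const (\<Prod>s<m. node i - node s) * newton_coeff m j)"
  by (rule fps_ext)
    (simp add: fps_nth_chi_power fps_sum_nth newton_coeff_def pcompose_altdef
        newton_interpolation[OF assms, where x = node])

lemma H_det_eq: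
  "H_det k d = fps_const (B_poly k) * det (mat k k (\<lambda>(m, j). newton_coeff m j))"
proof -
  let ?L = "mat k k (\<lambda>(i, m). fps_const (\<Prod>s<m. node i - node s))"
  let ?Q = "mat k k (\<lambda>(m, j). newton_coeff m j)"
  have "mat k k (\<lambda>(i, j). (chi ^^ i) ((tau ^^ j) d)) = ?L * ?Q"
    by (rule eq_matI) (auto simp: scalar_prod_def chi_tau_newton lessThan_atLeast0)
  then have "H_det k d = det ?L * det ?Q"
    by (simp add: H_det_def det_mult[of _ k])
  also have "det ?L = prod_list (diag_mat ?L)"
  proof (rule det_lower_triangular)
    fix i j assume "i < j" "j < k"
    \<comment> \<open>For j > i the factor with s = i vanishes.\<close>
    moreover from this have "(\<Prod>s<j. node i - node s) = 0" by (intro prod_zero) auto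
    ultimately show "?L $$ (i, j) = 0" by simp
  qed auto
  also have "\<dots> = (\<Prod>m<k. fps_const (\<Prod>s<m. node m - node s))"
    by (simp add: prod_list_diag_prod lessThan_atLeast0)
  also have "\<dots> = fps_const (B_poly k)"
    unfolding B_poly_def[where ?'f = 'f, folded q_def] node_def by (induction k) (simp_all add: mult.commute)
  finally show ?thesis .
qed

text \<open>Up to order e_m q^j the coefficients have degree at most m in t, because e_l q^j is
  larger for l > m. There the divided difference is just the coefficient of t^m.\<close>

lemma lead_at_newton_coeff: "lead_at (newton_coeff m j) (t_order q m * q ^ j) ((- 1) ^ m)"
proof -
  have "strict_mono (t_order q)" by (rule strict_mono_t_order[OF q_ge_2])
  then have less: "t_order q m * q ^ j < t_order q l * q ^ j" if "m < l" for l
    using that q_ge_2 by (simp add: strict_mono_def)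
  have nth: "fps_nth (newton_coeff m j) n = [:coeff (fps_nth ((tau ^^ j) d) n) m:]"
    if "n \<le> t_order q m * q ^ j" for n
    unfolding newton_coeff_def fps_nth_Abs_fps
  proof (subst divided_diff_low)
    fix l assume "m < l"
    then have "n < t_order q l * q ^ j" using less that by (meson le_less_trans)
    then show "coeff (map_poly (\<lambda>a. [:a:]) (fps_nth ((tau ^^ j) d) n)) l = 0"
      using lead_at_t_coeff_tau[of l j] by (simp add: coeff_map_poly lead_at_def t_coeff_def)
  qed (simp add: coeff_map_poly)
  with lead_at_t_coeff_tau[of m j] const_minus_one_power[of m, where ?'a = "'f poly"] show ?thesis
    by (simp add: lead_at_def t_coeff_def)
qed

lemma lead_at_det_newton_coeff:
  "lead_at (det (mat k k (\<lambda>(m, j). newton_coeff m j))) (\<Sum>m<k. t_order q m * q ^ (k - 1 - m)) 1"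
proof (rule lead_at_det[where w = "\<lambda>j. q ^ j"])
  show "strict_mono (\<lambda>j. q ^ j)" using q_ge_2 by (intro strict_monoI power_strict_increasing) auto
qed (use strict_mono_t_order[OF q_ge_2] lead_at_newton_coeff in auto)

text \<open>Strong induction through the functional equation: \<open>tau\<close> draws coefficient i
  = q j from the smaller index j, and if q - 1 does not divide i, it does not divide j.\<close>

lemma sparse_d:
  assumes g: "sparse (q - 1) g" and h: "sparse (q - 1) (Delta h)"
  shows "sparse (q - 1) d"
proof -
  have "fps_nth d n = 0" if "\<not> (q - 1) dvd n" for n
    using that
  proof (induction n rule: less_induct)
    case (less n)
    \<comment> \<open>Only indices strictly below i are assumed, so the induction hypothesis still
      reaches i = n, and the fact can be applied twice for \<open>tau (tau d)\<close>.\<close>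
    have tau: "fps_nth (tau f) i = 0"
      if "\<And>j. j \<le> n \<Longrightarrow> j < i \<Longrightarrow> \<not> (q - 1) dvd j \<Longrightarrow> fps_nth f j = 0" "i \<le> n" "\<not> (q - 1) dvd i" for i and f :: "'f poly poly fps"
    proof (cases "q dvd i")
      case True
      then obtain j where j: "i = q * j" by (elim dvdE)
      have "i \<noteq> 0" using that(3) by (metis dvd_0_right)
      then have "j < i" using j q_ge_2 by (simp add: n_less_m_mult_n)
      moreover have "\<not> (q - 1) dvd j" using that(3) j by auto
      ultimately have "fps_nth f j = 0" using that by auto
      then show ?thesis using j q_ge_2 by (simp add: fps_nth_tau[where ?'f = 'f, folded q_def])
    qed (simp add: fps_nth_tau[where ?'f = 'f, folded q_def])
    have tau1: "fps_nth (tau d) i = 0" if "i \<le> n" "\<not> (q - 1) dvd i" for i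
      using less.IH that by (intro tau) auto
    have tau2: "fps_nth (tau (tau d)) i = 0" if "i \<le> n" "\<not> (q - 1) dvd i" for i
      by (intro tau[of i "tau d"]) (use that tau1 in auto)
    have mult: "fps_nth (lift_series a * b) n = 0"
      if "sparse (q - 1) a" "\<And>i. i \<le> n \<Longrightarrow> \<not> (q - 1) dvd i \<Longrightarrow> fps_nth b i = 0" for a :: "'f poly fps" and b
      unfolding fps_mult_nth
    proof (intro sum.neutral ballI)
      fix i assume "i \<in> {0..n}"
      then have "i \<le> n" by simp
      then have "\<not> (q - 1) dvd i \<or> \<not> (q - 1) dvd (n - i)"
        using less.prems dvd_diffD by blast
      then show "fps_nth (lift_series a) i * fps_nth b (n - i) = 0"
        using that by (auto simp: lift_series_def sparse_def)
    qed
    have "fps_nth (lift_series g * tau d) n = 0"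
      by (intro mult g tau1)
    moreover have "fps_nth (lift_series (Delta h) * (fps_const (t_var - theta ^ q) * tau (tau d))) n = 0"
      by (intro mult h) (simp add: tau2)
    ultimately show ?case by (subst d_eq) simp
  qed
  then show ?thesis by (simp add: sparse_def)
qed

lemma sparse_newton_coeff:
  assumes "sparse (q - 1) d"
  shows "sparse (q - 1) (newton_coeff m j)"
proof -
  have "sparse (q - 1) ((tau ^^ j) d)"
  proof (induction j)
    case (Suc j)
    have "fps_nth (tau ((tau ^^ j) d)) n = 0" if "\<not> (q - 1) dvd n" for n
    proof (cases "q dvd n")
      case True
      then have "\<not> (q - 1) dvd (n div q)" using that by (metis dvd_mult dvd_mult_div_cancel)
      then show ?thesis using Suc by (simp add: sparse_def fps_nth_tau[where ?'f = 'f, folded q_def])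
    qed (simp add: fps_nth_tau[where ?'f = 'f, folded q_def])
    then show ?case by (simp add: sparse_def)
  qed (use assms in simp)
  then show ?thesis by (simp add: sparse_def newton_coeff_def)
qed

lemma B_poly_nonzero: "B_poly k \<noteq> (0 :: 'f poly poly)"
proof -
  have "t_var ^ q ^ j \<noteq> (t_var ^ q ^ i :: 'f poly poly)" if "i < j" for i j
  proof
    assume "t_var ^ q ^ j = (t_var ^ q ^ i :: 'f poly poly)"
    then have "degree (t_var ^ q ^ j :: 'f poly poly) = degree (t_var ^ q ^ i :: 'f poly poly)" by simp
    then have "q ^ j = q ^ i" by (simp add: t_var_def degree_power_eq)
    then show False using that q_ge_2 by simp
  qed
  then show ?thesis by (auto simp: B_poly_def[where ?'f = 'f, folded q_def])
qed

theorem H_det_properties: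
  assumes "sparse (q - 1) g" "sparse (q - 1) (Delta h)" "k \<ge> 1"
  defines "\<nu> \<equiv> subdegree (H_det k d)"
  shows "H_det k d \<noteq> 0"
    and "(of_nat \<nu> :: rat) = (of_nat q ^ k - 1) * (of_nat q ^ (k - 1) - 1) / (of_nat q ^ 2 - 1)"
    and "fps_nth (H_det k d) \<nu> = B_poly k"
    and "\<exists>F. H_det k d = fps_const (B_poly k) * F
            \<and> F \<in> range (\<lambda>G. fps_compose G (fps_X ^ (q - 1)))
            \<and> fps_nth F (subdegree F) = 1"
proof -
  let ?F = "det (mat k k (\<lambda>(m, j). newton_coeff m j))"
  let ?N = "\<Sum>m<k. t_order q m * q ^ (k - 1 - m)"
  have F: "lead_at ?F ?N 1" by (rule lead_at_det_newton_coeff)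
  have H: "lead_at (H_det k d) ?N (B_poly k)"
    using lead_at_mult[OF lead_at_const F, of "B_poly k"] by (simp add: H_det_eq)
  have subF: "subdegree ?F = ?N"
    using F by (intro subdegreeI) (auto simp: lead_at_def)
  have subH: "\<nu> = ?N"
    unfolding \<nu>_def using H B_poly_nonzero[of k] by (intro subdegreeI) (auto simp: lead_at_def)
  show "H_det k d \<noteq> 0" using H B_poly_nonzero[of k] by (auto simp: lead_at_def)
  show "(of_nat \<nu> :: rat) = (of_nat q ^ k - 1) * (of_nat q ^ (k - 1) - 1) / (of_nat q ^ 2 - 1)"
    unfolding subH by (rule sum_t_order[OF q_ge_2 \<open>k \<ge> 1\<close>])
  show "fps_nth (H_det k d) \<nu> = B_poly k"
    using H by (simp add: subH lead_at_def)
  have "sparse (q - 1) ?F"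
    by (intro sparse_det sparse_newton_coeff sparse_d assms)
  then have "?F \<in> range (\<lambda>G. fps_compose G (fps_X ^ (q - 1)))"
    using q_ge_2 by (intro sparse_imp_compose) auto
  moreover have "fps_nth ?F (subdegree ?F) = 1"
    using F by (simp add: subF lead_at_def)
  ultimately show "\<exists>F. H_det k d = fps_const (B_poly k) * F
            \<and> F \<in> range (\<lambda>G. fps_compose G (fps_X ^ (q - 1)))
            \<and> fps_nth F (subdegree F) = 1"
    using H_det_eq by blast
qed

end

section \<open>Power series over a nonarchimedean field\<close>

context C_infinity
begin

abbreviation absv :: "'c \<Rightarrow> real" where "absv x \<equiv> dist x 0"

lemma dist_minus: "absv (x - y) = dist x y"
  using dist_eq_abs_diff[of x y] by simp

lemma absv_one [simp]: "absv 1 = 1"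
proof -
  have "absv 1 * absv 1 = absv 1 * 1" using abs_mult[of 1 1] by simp
  then show ?thesis by (subst (asm) mult_left_cancel) auto
qed

lemma absv_minus [simp]: "absv (- x) = absv x"
  using dist_minus[of 0 x] by (simp add: dist_commute)

lemma absv_diff_le: "absv (x - y) \<le> max (absv x) (absv y)"
  using abs_ultrametric[of x "- y"] by simp

lemma absv_power: "absv (x ^ n) = absv x ^ n"
  by (induction n) (simp_all add: abs_mult)

lemma absv_inverse: "absv (inverse x) = inverse (absv x)"
proof (cases "x = 0")
  case False
  then have "absv x * absv (inverse x) = 1" by (metis abs_mult absv_one right_inverse)
  then show ?thesis by (metis inverse_unique)
qed simp

lemma absv_divide: "absv (x / y) = absv x / absv y"
  by (simp add: divide_inverse abs_mult absv_inverse)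

lemma absv_sum_le: "0 \<le> C \<Longrightarrow> (\<And>i. i \<in> I \<Longrightarrow> absv (f i) \<le> C) \<Longrightarrow> absv (sum f I) \<le> C"
proof (induction I rule: infinite_finite_induct)
  case (insert i I)
  have "absv (f i + sum f I) \<le> max (absv (f i)) (absv (sum f I))" by (rule abs_ultrametric)
  also have "\<dots> \<le> C" using insert by simp
  finally show ?case using insert by simp
qed auto

text \<open>The isosceles property of an ultrametric.\<close>

lemma absv_add_eq:
  assumes "absv x < absv y"
  shows "absv (x + y) = absv y"
proof (rule antisym)
  show "absv (x + y) \<le> absv y" using abs_ultrametric[of x y] assms by simp
  have "absv y \<le> max (absv (x + y)) (absv x)" using absv_diff_le[of "x + y" x] by simp
  then show "absv y \<le> absv (x + y)" using assms by simp
qed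

lemma dist_ultrametric: "dist (x :: 'c) z \<le> max (dist x y) (dist y z)"
  using abs_ultrametric[of "x - y" "y - z"] by (simp add: dist_minus)

text \<open>The type only carries a field structure and a metric; continuity of addition comes from
  the ultrametric inequality.\<close>

lemma tendsto_add_nonarch:
  fixes f g :: "'b \<Rightarrow> 'c"
  assumes "(f \<longlongrightarrow> a) F" "(g \<longlongrightarrow> b) F"
  shows "((\<lambda>x. f x + g x) \<longlongrightarrow> a + b) F"
proof -
  have "dist (f x + g x) (a + b) \<le> dist (f x) a + dist (g x) b" for x
  proof -
    have "dist (f x + g x) (a + b) = absv ((f x - a) + (g x - b))"
      by (subst dist_eq_abs_diff) (simp add: algebra_simps)
    also have "\<dots> \<le> max (dist (f x) a) (dist (g x) b)"
      using abs_ultrametric[of "f x - a" "g x - b"] by (simp add: dist_minus)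
    also have "\<dots> \<le> dist (f x) a + dist (g x) b" by simp
    finally show ?thesis .
  qed
  moreover have "((\<lambda>x. dist (f x) a + dist (g x) b) \<longlongrightarrow> 0) F"
    using tendsto_add[OF tendsto_dist[OF assms(1) tendsto_const[of a]] tendsto_dist[OF assms(2) tendsto_const[of b]]]
    by simp
  ultimately have "((\<lambda>x. dist (f x + g x) (a + b)) \<longlongrightarrow> 0) F"
    by - (rule tendsto_sandwich[of "\<lambda>_. 0" _ F "\<lambda>x. dist (f x) a + dist (g x) b"], simp_all)
  then show ?thesis by (rule tendsto_dist_iff[THEN iffD2])
qed

lemma tendsto_cmult_nonarch:
  fixes f :: "'b \<Rightarrow> 'c"
  assumes "(f \<longlongrightarrow> a) F"
  shows "((\<lambda>x. c * f x) \<longlongrightarrow> c * a) F"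
proof -
  have "dist (c * f x) (c * a) = absv c * dist (f x) a" for x
    using abs_mult[of c "f x - a"] by (simp add: dist_minus right_diff_distrib)
  moreover have "((\<lambda>x. absv c * dist (f x) a) \<longlongrightarrow> 0) F"
    using tendsto_mult_right_zero[of "\<lambda>x. dist (f x) a" F "absv c"] tendsto_dist_iff[of f a F] assms by simp
  ultimately have "((\<lambda>x. dist (c * f x) (c * a)) \<longlongrightarrow> 0) F" by simp
  then show ?thesis by (rule tendsto_dist_iff[THEN iffD2])
qed

lemma sums_add_nonarch:
  fixes f g :: "nat \<Rightarrow> 'c"
  assumes "f sums a" "g sums b"
  shows "(\<lambda>n. f n + g n) sums (a + b)"
  using tendsto_add_nonarch[of "\<lambda>n. sum f {..<n}" a sequentially "\<lambda>n. sum g {..<n}" b] assms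
  by (simp add: sums_def sum.distrib)

lemma sums_cmult_nonarch:
  fixes f :: "nat \<Rightarrow> 'c"
  assumes "f sums a"
  shows "(\<lambda>n. c * f n) sums (c * a)"
  using tendsto_cmult_nonarch[of "\<lambda>n. sum f {..<n}" a sequentially c] assms
  by (simp add: sums_def sum_distrib_left)

lemma sums_diff_nonarch:
  fixes f g :: "nat \<Rightarrow> 'c"
  assumes "f sums a" "g sums b"
  shows "(\<lambda>n. f n - g n) sums (a - b)"
  using sums_add_nonarch[OF assms(1) sums_cmult_nonarch[OF assms(2), of "- 1"]] by simp

lemma sums_remove_nonarch:
  fixes f :: "nat \<Rightarrow> 'c"
  assumes "f sums S"
  shows "(\<lambda>n. if n = m then 0 else f n) sums (S - f m)"
proof -
  have "(\<lambda>n. if n = m then f n else 0) sums f m" by (rule sums_single)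
  from sums_diff_nonarch[OF assms this] show ?thesis
    by (rule back_subst[where P = "\<lambda>f. f sums _"]) auto
qed

text \<open>By the ultrametric inequality the distance of two members is at most the largest step
  between them, so small steps already give a Cauchy sequence.\<close>

lemma convergent_nonarch:
  assumes "(\<lambda>n. dist (X (Suc n)) (X n)) \<longlonglongrightarrow> 0"
  shows "convergent (X :: nat \<Rightarrow> 'c)"
  unfolding Cauchy_convergent_iff[symmetric]
proof (rule metric_CauchyI)
  fix e :: real assume "0 < e"
  then obtain M where M: "\<And>n. n \<ge> M \<Longrightarrow> dist (X (Suc n)) (X n) < e"
    using order_tendstoD(2)[OF assms, of e] by (auto simp: eventually_sequentially)
  have close: "dist (X n) (X M) < e" if "M \<le> n" for n
    using that
  proof (induction n rule: dec_induct)
    case (step n)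
    then show ?case using dist_ultrametric[of "X (Suc n)" "X M" "X n"] M[of n] by simp
  qed (use \<open>0 < e\<close> in simp)
  show "\<exists>M. \<forall>m\<ge>M. \<forall>n\<ge>M. dist (X m) (X n) < e"
  proof (intro exI allI impI)
    fix m n assume "M \<le> m" "M \<le> n"
    then show "dist (X m) (X n) < e"
      using dist_ultrametric[of "X m" "X n" "X M"] close[of m] close[of n] by (simp add: dist_commute)
  qed
qed

lemma summable_nonarch:
  fixes f :: "nat \<Rightarrow> 'c"
  assumes "(\<lambda>n. absv (f n)) \<longlonglongrightarrow> 0"
  shows "summable f"
proof -
  have "dist (sum f {..<Suc n}) (sum f {..<n}) = absv (f n)" for n
    by (subst dist_eq_abs_diff) simp
  then have "convergent (\<lambda>n. sum f {..<n})" using assms by (intro convergent_nonarch) simp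
  then show ?thesis by (simp add: summable_iff_convergent)
qed

lemma sums_terms_tendsto_nonarch:
  fixes f :: "nat \<Rightarrow> 'c"
  assumes "f sums S"
  shows "(\<lambda>n. absv (f n)) \<longlonglongrightarrow> 0"
proof -
  let ?S = "\<lambda>n. sum f {..<n}"
  have S: "?S \<longlonglongrightarrow> S" using assms by (simp add: sums_def)
  have "(\<lambda>n. dist (?S (Suc n)) (?S n)) \<longlonglongrightarrow> dist S S"
    by (intro tendsto_dist S LIMSEQ_Suc[OF S])
  moreover have "dist (?S (Suc n)) (?S n) = absv (f n)" for n
    by (subst dist_eq_abs_diff) simp
  ultimately show ?thesis by simp
qed

lemma absv_sums_le:
  fixes f :: "nat \<Rightarrow> 'c"
  assumes "f sums S" "\<And>n. absv (f n) \<le> C"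
  shows "absv S \<le> C"
proof -
  have "0 \<le> C" using assms(2)[of 0] by (rule order_trans[OF zero_le_dist])
  have "(\<lambda>n. absv (sum f {..<n})) \<longlonglongrightarrow> absv S"
    using assms(1) by (intro tendsto_dist tendsto_const) (simp add: sums_def)
  then show ?thesis
    by (rule LIMSEQ_le_const2) (auto intro!: absv_sum_le \<open>0 \<le> C\<close> assms(2))
qed

lemma absv_sums_dominant:
  fixes f :: "nat \<Rightarrow> 'c"
  assumes "f sums S" "\<And>n. n \<noteq> m \<Longrightarrow> absv (f n) \<le> C" "C < absv (f m)" "0 \<le> C"
  shows "absv S = absv (f m)"
proof -
  have "absv (S - f m) \<le> C"
    by (rule absv_sums_le[OF sums_remove_nonarch[OF assms(1), of m]]) (use assms in auto)
  then have "absv ((S - f m) + f m) = absv (f m)" using assms by (intro absv_add_eq) simp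
  then show ?thesis by simp
qed

text \<open>If a_m were the first nonzero coefficient, convergence at \<open>u 0\<close> would bound
  the remaining terms, relative to (u j)^m, by a constant times |u j|, and |a_m| would be at most a
  quantity tending to 0.\<close>

lemma power_series_identity:
  fixes a u :: "nat \<Rightarrow> 'c"
  assumes sums: "\<And>j. (\<lambda>n. a n * u j ^ n) sums 0"
    and nonzero: "\<And>j. u j \<noteq> 0" and lim: "u \<longlonglongrightarrow> 0"
  shows "a n = 0"
proof (rule ccontr)
  assume "a n \<noteq> 0"
  define m where "m = (LEAST m. a m \<noteq> 0)"
  have am: "a m \<noteq> 0" unfolding m_def using \<open>a n \<noteq> 0\<close> by (rule LeastI)
  have below: "a i = 0" if "i < m" for i using not_less_Least that unfolding m_def by blast
  define r where "r = absv (u 0)"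
  have r: "0 < r" using nonzero by (simp add: r_def)
  have "Bseq (\<lambda>n. absv (a n * u 0 ^ n))"
    using sums_terms_tendsto_nonarch[OF sums[of 0]] by (intro convergent_imp_Bseq convergentI)
  then obtain C where C: "\<And>n. absv (a n) * r ^ n \<le> C"
    by (auto simp: Bseq_def abs_mult absv_power r_def)
  have C0: "0 \<le> C" using C[of 0] by (rule order_trans[rotated]) simp
  have bound: "absv (a m) \<le> C / r ^ Suc m * absv (u j)" if "absv (u j) \<le> r" for j
  proof -
    \<comment> \<open>Relative to radius r the terms beyond m shrink by at least s^(m+1); the
      ultrametric inequality gives the same bound for their sum.\<close>
    define s where "s = absv (u j) / r"
    have s: "0 \<le> s" "s \<le> 1" using r that by (auto simp: s_def)
    have uj: "absv (u j) = s * r" using r by (simp add: s_def)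
    have "absv (if n = m then 0 else a n * u j ^ n) \<le> C * s ^ Suc m" for n
    proof (cases "n \<le> m")
      case True
      then show ?thesis using below C0 s by (cases "n = m") (auto intro!: mult_nonneg_nonneg)
    next
      case False
      have "absv (a n * u j ^ n) = (absv (a n) * r ^ n) * s ^ n"
        by (simp add: abs_mult absv_power uj power_mult_distrib)
      also have "\<dots> \<le> C * s ^ Suc m"
        using C C0 s False by (intro mult_mono power_decreasing) auto
      finally show ?thesis using False by simp
    qed
    from absv_sums_le[OF sums_remove_nonarch[OF sums[of j], of m] this]
    have "absv (a m) * (s * r) ^ m \<le> C * s ^ Suc m"
      by (simp add: abs_mult absv_power uj)
    moreover have "0 < s" using nonzero[of j] r by (simp add: s_def)
    moreover from calculation have "s ^ m * (absv (a m) * r ^ m) \<le> s ^ m * (C * s)"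
      by (simp add: power_mult_distrib mult_ac)
    ultimately have "absv (a m) * r ^ m \<le> C * s" by simp
    then have "absv (a m) \<le> C * s / r ^ m" using r by (simp add: pos_le_divide_eq)
    also have "\<dots> = C / r ^ Suc m * absv (u j)" by (simp add: s_def)
    finally show ?thesis .
  qed
  have lim0: "(\<lambda>j. absv (u j)) \<longlonglongrightarrow> 0"
    using tendsto_dist[OF lim tendsto_const[of 0]] by simp
  then have "\<forall>\<^sub>F j in sequentially. absv (u j) < r" using r by (rule order_tendstoD)
  then have ev: "\<forall>\<^sub>F j in sequentially. absv (a m) \<le> C / r ^ Suc m * absv (u j)"
    by (rule eventually_mono) (rule bound, simp)
  have "absv (a m) \<le> 0"
    by (rule tendsto_lowerbound[OF tendsto_mult_right_zero[OF lim0] ev]) simp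
  then show False using am by simp
qed

end

section \<open>The Carlitz exponential\<close>

text \<open>The size of the i-th term of the Carlitz exponential at absolute value \<open>L\<close>.
  The base drops below 1/2 eventually, while the exponent is at least i.\<close>

lemma carlitz_bound_tendsto_0:
  fixes L :: real and Q :: nat
  assumes "Q \<ge> 2" "0 \<le> L"
  shows "(\<lambda>i. (L / real Q ^ i) ^ (Q ^ i)) \<longlonglongrightarrow> 0"
proof -
  have "(\<lambda>i. L * (1 / real Q) ^ i) \<longlonglongrightarrow> 0"
    using assms(1) by (intro tendsto_mult_right_zero LIMSEQ_power_zero) simp
  then have "(\<lambda>i. L / real Q ^ i) \<longlonglongrightarrow> 0" by (simp add: power_divide)
  then have "\<forall>\<^sub>F i in sequentially. L / real Q ^ i < 1 / 2"
    by (rule order_tendstoD) simp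
  then have "\<forall>\<^sub>F i in sequentially. (L / real Q ^ i) ^ (Q ^ i) \<le> (1 / 2) ^ i"
  proof (rule eventually_mono)
    fix i assume less: "L / real Q ^ i < 1 / 2"
    have "i \<le> Q ^ i" using assms(1) by (rule self_le_ge2_pow)
    have "(L / real Q ^ i) ^ (Q ^ i) \<le> (1 / 2) ^ (Q ^ i)"
      using less assms by (intro power_mono) auto
    also have "\<dots> \<le> (1 / 2) ^ i" using \<open>i \<le> Q ^ i\<close> by (intro power_decreasing) auto
    finally show "(L / real Q ^ i) ^ (Q ^ i) \<le> (1 / 2) ^ i" .
  qed
  moreover have "\<forall>\<^sub>F i in sequentially. 0 \<le> (L / real Q ^ i) ^ (Q ^ i)"
    using assms(2) by simp
  moreover have "(\<lambda>i. (1 / 2 :: real) ^ i) \<longlonglongrightarrow> 0" by (rule LIMSEQ_power_zero) simp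
  ultimately show ?thesis
    by - (rule tendsto_sandwich[OF _ _ tendsto_const])
qed

text \<open>The right side of \<open>r ^ (Q - 1) = Q ^ Q\<close> is the ratio at which two consecutive terms of the Carlitz
  exponential tie; an argument strictly between two such radii has a unique dominant term.\<close>

lemma carlitz_dominant_term:
  fixes Q n :: nat and r x :: real
  assumes Q: "Q \<ge> 2" and r: "r > 0" "r ^ (Q - 1) = real Q ^ Q"
    and x: "real Q ^ n < x" "x < real Q ^ Suc n"
  defines "T \<equiv> \<lambda>i. (r * x / real Q ^ i) ^ (Q ^ i)"
  shows "T 0 < T (Suc n)" "\<exists>C\<ge>0. C < T (Suc n) \<and> (\<forall>i. i \<noteq> Suc n \<longrightarrow> T i \<le> C)"
proof -
  have Qpos: "0 < real Q ^ i" for i using Q by (intro zero_less_power) auto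
  have x0: "0 < x" using Qpos x(1) by (rule less_trans)
  have pos: "0 < r * x / real Q ^ i" for i using Qpos x0 r(1) by simp
  have T0: "0 < T i" for i using r x0 Q by (simp add: T_def)
  \<comment> \<open>By the choice of \<open>r\<close>, the next term arises by multiplying the base
    of the Q^i-th power by (x / Q^i)^(Q-1): terms grow while Q^i < x and fall once Q^i > x.\<close>
  have step: "T (Suc i) = (r * x / real Q ^ i * (x / real Q ^ i) ^ (Q - 1)) ^ (Q ^ i)" for i
  proof -
    define y where "y = x / real Q ^ i"
    have "(r * y / real Q) ^ Q = (r * y) * (r * y) ^ (Q - 1) / real Q ^ Q"
      using Q power_eq_if[of "r * y" Q] by (simp add: power_divide)
    also have "\<dots> = r * y * y ^ (Q - 1)" using r Q by (simp add: power_mult_distrib)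
    finally have "((r * y / real Q) ^ Q) ^ (Q ^ i) = (r * y * y ^ (Q - 1)) ^ (Q ^ i)" by simp
    moreover have "r * x / real Q ^ Suc i = r * y / real Q" by (simp add: y_def)
    ultimately show ?thesis by (simp only: T_def power_Suc[of Q i] power_mult) (simp add: y_def)
  qed
  have up: "T i < T (Suc i)" if "i \<le> n" for i
  proof -
    have "real Q ^ i \<le> real Q ^ n" using that Q by (intro power_increasing) auto
    then have "real Q ^ i < x" using x(1) by (rule le_less_trans)
    then have "1 < x / real Q ^ i" using Qpos[of i] by (simp add: less_divide_eq)
    then have "1 < (x / real Q ^ i) ^ (Q - 1)" using Q by (intro one_less_power) auto
    then have "r * x / real Q ^ i < r * x / real Q ^ i * (x / real Q ^ i) ^ (Q - 1)"
      using mult_strict_left_mono[OF _ pos[of i]] by fastforce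
    then show ?thesis
      unfolding step unfolding T_def using r x0 Q by (intro power_strict_mono) auto
  qed
  have down: "T (Suc i) < T i" if "Suc n \<le> i" for i
  proof -
    have "real Q ^ Suc n \<le> real Q ^ i" using that Q by (intro power_increasing) auto
    with x(2) have "x < real Q ^ i" by (rule less_le_trans)
    then have "x / real Q ^ i < 1" using Qpos[of i] by (simp add: divide_less_eq)
    then have "(x / real Q ^ i) ^ (Q - 1) < 1"
      using power_strict_mono[of "x / real Q ^ i" 1 "Q - 1"] Q x0 by simp
    then have "r * x / real Q ^ i * (x / real Q ^ i) ^ (Q - 1) < r * x / real Q ^ i"
      using mult_strict_left_mono[OF _ pos[of i]] by fastforce
    then show ?thesis
      unfolding step unfolding T_def using r x0 Q by (intro power_strict_mono) auto
  qed
  have left: "T i \<le> T n" if "i \<le> n" for i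
    using that
  proof (induction rule: inc_induct)
    case (step i)
    then show ?case using up[of i] by simp
  qed simp
  have right: "T i \<le> T (Suc (Suc n))" if "Suc (Suc n) \<le> i" for i
    using that
  proof (induction rule: dec_induct)
    case (step i)
    then show ?case using down[of i] by simp
  qed simp
  show "T 0 < T (Suc n)" using left[of 0] up[of n] by simp
  show "\<exists>C\<ge>0. C < T (Suc n) \<and> (\<forall>i. i \<noteq> Suc n \<longrightarrow> T i \<le> C)"
  proof (intro exI[of _ "max (T n) (T (Suc (Suc n)))"] conjI allI impI)
    fix i assume "i \<noteq> Suc n"
    then have "i \<le> n \<or> Suc (Suc n) \<le> i" by linarith
    then show "T i \<le> max (T n) (T (Suc (Suc n)))" using left right by (auto simp: le_max_iff_disj)
  qed (use up[of n] down[of "Suc n"] T0[of n] in auto)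
qed

text \<open>\<open>(X + 1) ^ q - X ^ q - 1\<close> has degree less than \<open>q\<close> and vanishes on all of \<open>\<F>\<^sub>q\<close>.\<close>

lemma of_nat_card_choose:
  assumes "0 < i" "i < CARD('f::finite_field)"
  shows "of_nat (CARD('f) choose i) = (0 :: 'f)"
proof -
  let ?q = "CARD('f)"
  define p :: "'f poly" where "p = (\<Sum>i\<in>{1..<?q}. monom (of_nat (?q choose i)) i)"
  have split: "{..?q} = insert 0 (insert ?q {1..<?q})" using card_ge_2[where ?'f = 'f] by auto
  have "poly p x = 0" for x
  proof -
    have "(x + 1) ^ ?q = (\<Sum>k\<le>?q. of_nat (?q choose k) * x ^ k)"
      by (simp add: binomial_ring)
    also have "\<dots> = 1 + x ^ ?q + poly p x"
      unfolding split p_def poly_sum by (simp add: poly_monom)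
    finally show ?thesis by (simp add: finite_field_power_card_eq_same)
  qed
  then have roots: "{x. poly p x = 0} = UNIV" by auto
  have "degree p < ?q"
    unfolding p_def using card_ge_2[where ?'f = 'f]
    by (intro degree_sum_less) (auto intro: le_less_trans[OF degree_monom_le])
  moreover have "?q \<le> degree p" if "p \<noteq> 0" using card_poly_roots_bound[OF that] by (simp add: roots)
  ultimately have "p = 0" by linarith
  moreover have "coeff p i = of_nat (?q choose i)"
    unfolding p_def using assms by (simp add: coeff_sum)
  ultimately show ?thesis by simp
qed

lemma carlitz_D_0 [simp]: "carlitz_D 0 = 1"
  by (simp add: carlitz_D_def)

lemma degree_X_power_diff:
  assumes "b < a"
  shows "degree ([:0, 1:] ^ a - [:0, 1:] ^ b :: 'a::field poly) = a"
proof -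
  have "degree ([:0, 1:] ^ a + - ([:0, 1:] ^ b) :: 'a poly) = degree ([:0, 1:] ^ a :: 'a poly)"
    by (rule degree_add_eq_left) (use assms in \<open>simp add: degree_power_eq\<close>)
  then show ?thesis by (simp add: degree_power_eq)
qed

context C_infinity
begin

text \<open>Nonzero constants are roots of unity, of order dividing q - 1.\<close>

lemma absv_emb_const:
  assumes "a \<noteq> 0"
  shows "absv (emb [:a:]) = 1"
proof -
  have "a * a ^ (CARD('f) - 1) = a * 1"
    using finite_field_power_card_eq_same[of a] power_eq_if[of a "CARD('f)"] card_ge_2[where ?'f = 'f] by simp
  then have "a ^ (CARD('f) - 1) = 1" using assms by (subst (asm) mult_left_cancel) auto
  then have "[:a:] ^ (CARD('f) - 1) = 1" by (simp add: poly_const_pow one_pCons)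
  then have "emb [:a:] ^ (CARD('f) - 1) = 1" by (metis hom_power hom_one)
  then have "absv (emb [:a:]) ^ (CARD('f) - 1) = 1 ^ (CARD('f) - 1)"
    by (simp flip: absv_power)
  then show ?thesis
    by (rule power_eq_imp_eq_base) (use card_ge_2[where ?'f = 'f] in auto)
qed

text \<open>Horner induction: theta times a nonzero polynomial has absolute value above 1 and
  dominates the added constant.\<close>

lemma absv_emb: "a \<noteq> 0 \<Longrightarrow> absv (emb a) = real CARD('f) ^ degree a"
proof (induction a)
  case (pCons c p)
  have split: "emb (pCons c p) = emb [:c:] + emb [:0, 1:] * emb p"
    by (simp flip: hom_add hom_mult)
  show ?case
  proof (cases "p = 0")
    case True
    then show ?thesis using pCons.prems absv_emb_const by simp
  next
    case False
    then have "absv (emb [:0, 1:] * emb p) = real CARD('f) ^ Suc (degree p)"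
      using pCons.IH by (simp add: abs_mult abs_theta)
    moreover have "1 < real CARD('f) ^ Suc (degree p)"
      using card_ge_2[where ?'f = 'f] by (intro one_less_power) auto
    moreover have "absv (emb [:c:]) \<le> 1" using absv_emb_const[of c] by (cases "c = 0") auto
    ultimately show ?thesis unfolding split using False by (subst absv_add_eq) auto
  qed
qed simp

lemma emb_nonzero: "a \<noteq> 0 \<Longrightarrow> emb a \<noteq> 0"
  using absv_emb[of a] by auto

text \<open>Each of the i factors has degree q^i. Written as a q^i-th power, the value combines with
  z^(q^i) into a power of |z| / q^i.\<close>

lemma absv_carlitz_D: "absv (emb (carlitz_D i)) = (real CARD('f) ^ i) ^ (CARD('f) ^ i)"
proof -
  have "absv (emb ([:0, 1:] ^ (CARD('f) ^ i) - [:0, 1:] ^ (CARD('f) ^ j))) = real CARD('f) ^ (CARD('f) ^ i)"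
    if "j < i" for j
  proof -
    have "CARD('f) ^ j < CARD('f) ^ i"
      using that card_ge_2[where ?'f = 'f] by (intro power_strict_increasing) auto
    then have deg: "degree ([:0, 1:] ^ (CARD('f) ^ i) - [:0, 1:] ^ (CARD('f) ^ j) :: 'f poly) = CARD('f) ^ i"
      by (rule degree_X_power_diff)
    moreover have "CARD('f) ^ i > 0" using card_ge_2[where ?'f = 'f] by simp
    ultimately have "[:0, 1:] ^ (CARD('f) ^ i) - [:0, 1:] ^ (CARD('f) ^ j) \<noteq> (0 :: 'f poly)"
      by (metis degree_0 less_numeral_extra(3))
    then show ?thesis by (subst absv_emb) (simp_all add: deg)
  qed
  note factor = this
  have "absv (emb (\<Prod>j<m. [:0, 1:] ^ (CARD('f) ^ i) - [:0, 1:] ^ (CARD('f) ^ j)))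
      = (real CARD('f) ^ (CARD('f) ^ i)) ^ m" if "m \<le> i" for m
    using that
  proof (induction m)
    case (Suc m)
    then show ?case
      by (simp only: prod.lessThan_Suc hom_mult abs_mult factor Suc_le_lessD) simp
  qed simp
  from this[of i] show ?thesis
    by (simp add: carlitz_D_def power_mult[symmetric] mult.commute)
qed

text \<open>The middle binomial coefficients for exponent q vanish in the finite field and hence,
  through \<open>emb\<close>, in \<open>'c\<close>; this is iterated \<open>i\<close> times.\<close>

lemma frobenius_add: "(x + y) ^ (CARD('f) ^ i) = x ^ (CARD('f) ^ i) + (y :: 'c) ^ (CARD('f) ^ i)"
proof (induction i arbitrary: x y)
  case (Suc i)
  let ?q = "CARD('f)"
  have zero: "of_nat (?q choose k) = (0 :: 'c)" if "0 < k" "k < ?q" for k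
  proof -
    have "emb (of_nat (?q choose k)) = 0"
      using of_nat_card_choose[OF that] by (simp add: of_nat_poly)
    then show ?thesis by (simp add: hom_of_nat)
  qed
  have split: "{..?q} = insert 0 (insert ?q {1..<?q})" using card_ge_2[where ?'f = 'f] by auto
  have "(x + y) ^ ?q = x ^ ?q + y ^ ?q"
    unfolding binomial_ring split using zero by simp
  then have "(x + y) ^ (?q * ?q ^ i) = (x ^ ?q + y ^ ?q) ^ (?q ^ i)" by (simp add: power_mult)
  also have "\<dots> = x ^ (?q * ?q ^ i) + y ^ (?q * ?q ^ i)"
    by (subst Suc.IH) (simp add: power_mult)
  finally show ?case by simp
qed simp

definition carlitz_term :: "nat \<Rightarrow> 'c \<Rightarrow> 'c" where
  "carlitz_term i z = z ^ (CARD('f) ^ i) / emb (carlitz_D i)"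

lemma absv_carlitz_term: "absv (carlitz_term i z) = (absv z / real CARD('f) ^ i) ^ (CARD('f) ^ i)"
  by (simp add: carlitz_term_def absv_divide absv_power absv_carlitz_D power_divide)

lemma carlitz_term_add: "carlitz_term i (x + y) = carlitz_term i x + carlitz_term i y"
  by (simp add: carlitz_term_def frobenius_add add_divide_distrib)

lemma carlitz_term_const_mult: "carlitz_term i (emb [:a:] * z) = emb [:a:] * carlitz_term i z"
proof -
  have "emb [:a:] ^ (CARD('f) ^ i) = emb [:a:]"
    using finite_field_power_card_power_eq_same[OF refl, of a i]
    by (simp add: poly_const_pow flip: hom_power)
  then show ?thesis by (simp add: carlitz_term_def power_mult_distrib)
qed

lemma carlitz_sums: "(\<lambda>i. carlitz_term i z) sums carlitz_exp emb z"
proof -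
  have "summable (\<lambda>i. carlitz_term i z)"
    by (intro summable_nonarch, unfold absv_carlitz_term, intro carlitz_bound_tendsto_0 card_ge_2) auto
  then show ?thesis
    by (simp add: carlitz_exp_def carlitz_term_def[abs_def] summable_sums)
qed

lemma carlitz_exp_add: "carlitz_exp emb (x + y) = carlitz_exp emb x + carlitz_exp emb y"
  using sums_add_nonarch[OF carlitz_sums[of x] carlitz_sums[of y]] carlitz_sums[of "x + y"]
  by (simp add: carlitz_term_add sums_unique2)

lemma carlitz_exp_const_mult: "carlitz_exp emb (emb [:a:] * z) = emb [:a:] * carlitz_exp emb z"
  using sums_cmult_nonarch[OF carlitz_sums[of z], of "emb [:a:]"] carlitz_sums[of "emb [:a:] * z"]
  by (simp add: carlitz_term_const_mult sums_unique2)

text \<open>The first slope of the Newton polygon: if all roots were larger than r = |p_0|, then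
  |p_1| r < |p_0|, against p_1 = 1.\<close>

lemma small_root:
  fixes p :: "'c poly"
  assumes p1: "coeff p 1 = 1"
  shows "\<exists>w. poly p w = 0 \<and> absv w \<le> absv (coeff p 0)"
proof (cases "coeff p 0 = 0")
  case True
  then show ?thesis by (intro exI[of _ 0]) (simp add: poly_0_coeff_0)
next
  case False
  define r where "r = absv (coeff p 0)"
  have "p \<noteq> 0" using p1 by auto
  then obtain A c where A: "p = Polynomial.smult c (\<Prod>x\<in>#A. [:-x, 1:])"
    using alg_closed_imp_factorization by blast
  \<comment> \<open>Induction on the multiset of roots; the empty product 1 satisfies 0 < 1.\<close>
  have prod: "absv (coeff (\<Prod>x\<in>#B. [:-x, 1:]) 1) * r < absv (coeff (\<Prod>x\<in>#B. [:-x, 1:]) 0)"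
    if "\<And>x. x \<in># B \<Longrightarrow> r < absv x" for B
    using that
  proof (induction B)
    case (add x B)
    let ?P = "\<Prod>x\<in>#B. [:-x, 1:]"
    let ?a = "absv (coeff ?P 1)" and ?b = "absv (coeff ?P 0)"
    have IH: "?a * r < ?b" using add by simp
    have b: "0 < ?b" using IH by (rule le_less_trans[rotated]) (simp add: r_def)
    have x: "r < absv x" using add.prems by simp
    have c0: "coeff ([:-x, 1:] * ?P) 0 = - x * coeff ?P 0" by simp
    have c1: "coeff ([:-x, 1:] * ?P) 1 = coeff ?P 0 - x * coeff ?P 1" by simp
    have "absv (coeff ([:-x, 1:] * ?P) 1) \<le> max ?b (absv x * ?a)"
      unfolding c1 using absv_diff_le[of "coeff ?P 0" "x * coeff ?P 1"] by (simp add: abs_mult)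
    then have "absv (coeff ([:-x, 1:] * ?P) 1) * r \<le> max ?b (absv x * ?a) * r"
      by (rule mult_right_mono) (simp add: r_def)
    also have "\<dots> < absv x * ?b"
    proof -
      have "?b * r < absv x * ?b" using x b by (simp add: mult.commute)
      moreover have "0 < absv x" using x by (rule le_less_trans[rotated]) (simp add: r_def)
      then have "absv x * ?a * r < absv x * ?b" using IH by (simp add: mult.assoc)
      ultimately show ?thesis by (simp add: max_def)
    qed
    also have "\<dots> = absv (coeff ([:-x, 1:] * ?P) 0)" unfolding c0 by (simp add: abs_mult)
    finally show ?case by simp
  qed simp
  have "\<exists>x. x \<in># A \<and> absv x \<le> r"
  proof (rule ccontr)
    assume "\<nexists>x. x \<in># A \<and> absv x \<le> r"
    then have "r < absv x" if "x \<in># A" for x using that by (meson not_le)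
    then have "absv (coeff (\<Prod>x\<in>#A. [:-x, 1:]) 1) * r < absv (coeff (\<Prod>x\<in>#A. [:-x, 1:]) 0)"
      by (rule prod)
    moreover have "0 < absv c" using \<open>p \<noteq> 0\<close> A by auto
    ultimately have "absv (c) * (absv (coeff (\<Prod>x\<in>#A. [:-x, 1:]) 1) * r)
        < absv (c) * absv (coeff (\<Prod>x\<in>#A. [:-x, 1:]) 0)"
      by (rule mult_strict_left_mono)
    moreover have "coeff p i = c * coeff (\<Prod>x\<in>#A. [:-x, 1:]) i" for i
      by (subst A) simp
    ultimately have "absv (coeff p 1) * r < absv (coeff p 0)"
      by (simp only: abs_mult mult.assoc)
    then show False by (simp only: p1 absv_one r_def)
  qed
  then obtain x where x: "x \<in># A" "absv x \<le> r" by blast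
  have "poly p x = 0"
    by (subst A) (use x(1) in \<open>auto simp: poly_prod_mset prod_mset_zero_iff\<close>)
  then show ?thesis using x(2) by (auto simp: r_def)
qed

end

section \<open>Zeros of the Carlitz exponential and small values of the uniformiser\<close>

context C_infinity
begin

text \<open>\<open>small_root\<close> applied to the partial sum minus \<open>b\<close>: only i = 0
  contributes to the linear coefficient, which is 1 / D_0 = 1.\<close>

lemma carlitz_partial_surj:
  "\<exists>w. (\<Sum>i\<le>n. carlitz_term i w) = b \<and> absv w \<le> absv b"
proof -
  define p where "p = (\<Sum>i\<le>n. monom (1 / emb (carlitz_D i)) (CARD('f) ^ i)) - [:b:]"
  have "CARD('f) ^ i = 1 \<longleftrightarrow> i = 0" for i
    using card_ge_2[where ?'f = 'f] by auto
  then have "coeff p 1 = (\<Sum>i\<le>n. if i = 0 then 1 / emb (carlitz_D i) else 0)"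
    by (simp add: p_def coeff_sum coeff_monom)
  also have "\<dots> = 1" by simp
  finally obtain w where w: "poly p w = 0" "absv w \<le> absv (coeff p 0)"
    using small_root[of p] by blast
  have "coeff p 0 = - b"
    using card_ge_2[where ?'f = 'f] by (simp add: p_def coeff_sum coeff_monom)
  moreover have "poly p w = (\<Sum>i\<le>n. carlitz_term i w) - b"
    by (simp add: p_def poly_sum poly_monom carlitz_term_def)
  ultimately show ?thesis using w by auto
qed

lemma carlitz_partial_add:
  "(\<Sum>i\<le>n. carlitz_term i (x + y)) = (\<Sum>i\<le>n. carlitz_term i x) + (\<Sum>i\<le>n. carlitz_term i y)"
  by (simp add: carlitz_term_add sum.distrib)

lemma absv_carlitz_partial_le:
  assumes "absv z \<le> 1"
  shows "absv (\<Sum>i\<le>n. carlitz_term i z) \<le> absv z"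
proof (rule absv_sum_le)
  fix i
  have q1: "1 \<le> real CARD('f) ^ i" "0 < CARD('f) ^ i"
    using card_ge_2[where ?'f = 'f] by (auto intro: one_le_power)
  have "absv (carlitz_term i z) \<le> (absv z / 1) ^ (CARD('f) ^ i)"
    unfolding absv_carlitz_term using q1 by (intro power_mono divide_left_mono) auto
  also have "\<dots> \<le> absv z ^ 1"
    using assms q1 by (simp only: div_by_1) (intro power_decreasing, auto)
  finally show "absv (carlitz_term i z) \<le> absv z" by simp
qed simp

text \<open>A nonzero zero of smallest absolute value, as a limit of zeros of the partial sums: a zero of one
  partial sum is moved to a zero of the next by a correction of size at most one.\<close>

lemma carlitz_exp_zero:
  "\<exists>z. carlitz_exp emb z = 0 \<and> absv z ^ (CARD('f) - 1) = real CARD('f) ^ CARD('f)"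
proof -
  let ?q = "CARD('f)"
  have q2: "?q \<ge> 2" by (rule card_ge_2)
  \<comment> \<open>A nonzero zero of the partial sum z + z^q / D_1.\<close>
  obtain z1 where z1: "z1 ^ (?q - 1) = - emb (carlitz_D 1)"
    using nth_root_exists[of "?q - 1" "- emb (carlitz_D 1)"] q2 by auto
  define r where "r = absv z1"
  have r_power: "r ^ (?q - 1) = real ?q ^ ?q"
    unfolding r_def absv_power[symmetric] z1 by (simp add: absv_carlitz_D)
  have r_nonneg: "0 \<le> r" by (simp add: r_def)
  have "1 < real ?q ^ ?q" using q2 by (intro one_less_power) auto
  then have r1: "1 < r" using r_power r_nonneg by (metis not_le power_le_one)
  \<comment> \<open>Because q <= 2 (q - 1). It makes every later correction at most 1, hence smaller
    than r.\<close>
  have r2: "r \<le> real ?q ^ 2"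
  proof (rule ccontr)
    assume "\<not> r \<le> real ?q ^ 2"
    then have "(real ?q ^ 2) ^ (?q - 1) < r ^ (?q - 1)"
      using q2 by (intro power_strict_mono) auto
    moreover have "real ?q ^ ?q \<le> (real ?q ^ 2) ^ (?q - 1)"
      unfolding power_mult[symmetric] using q2 by (intro power_increasing) auto
    ultimately show False using r_power by simp
  qed
  define \<epsilon> where "\<epsilon> n = (r / real ?q ^ n) ^ (?q ^ n)" for n
  have \<epsilon>_le: "\<epsilon> (Suc (Suc n)) \<le> 1" for n
  proof -
    have "real ?q ^ 2 \<le> real ?q ^ Suc (Suc n)" using q2 by (intro power_increasing) auto
    then have "r \<le> real ?q ^ Suc (Suc n)" using r2 by (rule order_trans[rotated])
    then have "r / real ?q ^ Suc (Suc n) \<le> 1" using q2 by (simp add: divide_le_eq)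
    then show ?thesis unfolding \<epsilon>_def using r_nonneg by (intro power_le_one) auto
  qed
  have "\<exists>z. \<forall>n. ((\<Sum>i\<le>Suc n. carlitz_term i (z n)) = 0 \<and> absv (z n) = r)
      \<and> dist (z (Suc n)) (z n) \<le> \<epsilon> (Suc (Suc n))"
  proof (rule dependent_nat_choice)
    have "emb (carlitz_D 1) \<noteq> 0"
      using absv_carlitz_D[of 1] q2 by auto
    moreover have "z1 ^ ?q = z1 * - emb (carlitz_D 1)"
      using power_eq_if[of z1 ?q] q2 z1 by simp
    ultimately show "\<exists>z. (\<Sum>i\<le>Suc 0. carlitz_term i z) = 0 \<and> absv z = r"
      by (intro exI[of _ z1]) (simp add: carlitz_term_def r_def)
  next
    fix z n assume z: "(\<Sum>i\<le>Suc n. carlitz_term i z) = 0 \<and> absv z = r"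
    \<comment> \<open>\<open>w\<close> is chosen so that its partial sum cancels the new term at
      \<open>z\<close>; by additivity \<open>w + z\<close> is then a zero of the longer sum. As |w|
      <= 1 < r, its absolute value is still r.\<close>
    obtain w where w: "(\<Sum>i\<le>Suc (Suc n). carlitz_term i w) = - carlitz_term (Suc (Suc n)) z"
      "absv w \<le> absv (- carlitz_term (Suc (Suc n)) z)"
      using carlitz_partial_surj by blast
    have small: "absv w \<le> \<epsilon> (Suc (Suc n))"
      using w(2) z by (simp add: absv_carlitz_term \<epsilon>_def)
    have zero: "(\<Sum>i\<le>Suc (Suc n). carlitz_term i (w + z)) = 0"
      unfolding carlitz_partial_add w(1) using z by simp
    have "absv w < absv z" using small \<epsilon>_le[of n] r1 z by linarith
    then have "absv (w + z) = r" using absv_add_eq z by simp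
    moreover have "dist (w + z) z = absv w" by (subst dist_eq_abs_diff) simp
    ultimately show "\<exists>y. ((\<Sum>i\<le>Suc (Suc n). carlitz_term i y) = 0 \<and> absv y = r)
        \<and> dist y z \<le> \<epsilon> (Suc (Suc n))"
      using zero small by auto
  qed
  then obtain z where z: "\<And>n. (\<Sum>i\<le>Suc n. carlitz_term i (z n)) = 0" "\<And>n. absv (z n) = r"
    "\<And>n. dist (z (Suc n)) (z n) \<le> \<epsilon> (Suc (Suc n))"
    by blast
  have "\<epsilon> \<longlonglongrightarrow> 0"
    unfolding \<epsilon>_def using carlitz_bound_tendsto_0[OF q2 r_nonneg] .
  then have "(\<lambda>n. \<epsilon> (Suc (Suc n))) \<longlonglongrightarrow> 0" by (intro LIMSEQ_Suc)
  then have "(\<lambda>n. dist (z (Suc n)) (z n)) \<longlonglongrightarrow> 0"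
    by - (rule tendsto_sandwich[OF _ _ tendsto_const], auto simp: z(3))
  then obtain l where l: "z \<longlonglongrightarrow> l"
    using convergent_nonarch convergent_def by blast
  have "(\<lambda>n. absv (z n)) \<longlonglongrightarrow> absv l" by (intro tendsto_dist l tendsto_const)
  then have "absv l = r" using z(2) by (simp add: LIMSEQ_const_iff)
  have lz: "(\<lambda>n. dist (z n) l) \<longlonglongrightarrow> 0" using l by (simp add: tendsto_dist_iff[symmetric])
  \<comment> \<open>By additivity the zero \<open>z n\<close> may be subtracted from
    \<open>l\<close>, and on arguments of size at most 1 a partial sum is no larger than its
    argument.\<close>
  have "\<forall>\<^sub>F n in sequentially. dist (\<Sum>i\<le>Suc n. carlitz_term i l) 0 \<le> dist (z n) l"
    using order_tendstoD(2)[OF lz, of 1, simplified]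
  proof (rule eventually_mono)
    fix n assume "dist (z n) l < 1"
    have eq: "absv (l - z n) = dist (z n) l" by (rule trans[OF dist_minus dist_commute])
    with \<open>dist (z n) l < 1\<close> have "absv (l - z n) \<le> 1" by linarith
    moreover have "(\<Sum>i\<le>Suc n. carlitz_term i l) = (\<Sum>i\<le>Suc n. carlitz_term i (l - z n))"
      using carlitz_partial_add[of "l - z n" "z n" "Suc n"] z(1)[of n] by simp
    ultimately show "dist (\<Sum>i\<le>Suc n. carlitz_term i l) 0 \<le> dist (z n) l"
      using absv_carlitz_partial_le[of "l - z n" "Suc n"] eq by (simp only:)
  qed
  then have "(\<lambda>n. dist (\<Sum>i\<le>Suc n. carlitz_term i l) 0) \<longlonglongrightarrow> 0"
    by - (rule tendsto_sandwich[OF _ _ tendsto_const lz], auto)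
  then have "(\<lambda>n. \<Sum>i\<le>Suc n. carlitz_term i l) \<longlonglongrightarrow> 0" by (rule tendsto_dist_iff[THEN iffD2])
  moreover have "(\<lambda>n. \<Sum>i\<le>Suc n. carlitz_term i l) \<longlonglongrightarrow> carlitz_exp emb l"
    using carlitz_sums[of l] by (intro LIMSEQ_Suc) (simp add: sums_def_le)
  ultimately have "carlitz_exp emb l = 0" by (rule LIMSEQ_unique[rotated])
  then show ?thesis using \<open>absv l = r\<close> r_power by auto
qed

text \<open>For |z| strictly between q^n and q^(n+1) the term n + 1 strictly dominates, so it gives
  the absolute value of the sum; it also exceeds the term for index 0, which is
  \<open>z0 * z\<close>.\<close>

lemma carlitz_exp_large:
  assumes z0: "absv z0 ^ (CARD('f) - 1) = real CARD('f) ^ CARD('f)"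
    and z: "real CARD('f) ^ n < absv z" "absv z < real CARD('f) ^ Suc n"
  shows "absv z0 * absv z \<le> absv (carlitz_exp emb (z0 * z))"
proof -
  let ?q = "CARD('f)"
  have q2: "?q \<ge> 2" by (rule card_ge_2)
  have "absv z0 \<noteq> 0"
  proof
    assume "absv z0 = 0"
    then have "real ?q ^ ?q = 0" using z0 q2 by (simp add: power_0_left)
    then show False using q2 by simp
  qed
  then have r: "0 < absv z0" by simp
  note dom = carlitz_dominant_term[OF q2 r z0 z]
  have T: "absv (carlitz_term i (z0 * z)) = (absv z0 * absv z / real ?q ^ i) ^ (?q ^ i)" for i
    by (simp add: absv_carlitz_term abs_mult)
  obtain C where C: "0 \<le> C" "C < absv (carlitz_term (Suc n) (z0 * z))"
    "\<And>i. i \<noteq> Suc n \<Longrightarrow> absv (carlitz_term i (z0 * z)) \<le> C"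
    using dom(2) unfolding T by blast
  have "absv (carlitz_exp emb (z0 * z)) = absv (carlitz_term (Suc n) (z0 * z))"
    by (rule absv_sums_dominant[OF carlitz_sums C(3,2,1)])
  then show ?thesis using dom(1) unfolding T by simp
qed

text \<open>If |z| is not the absolute value of an element of K, the isosceles property gives |z -
  x| >= |z| for all x in K. This is a closed condition, so it extends to the closure.\<close>

lemma drinfeld_plane_imag_abs:
  assumes "\<And>a b. absv z * real CARD('f) ^ b \<noteq> real CARD('f) ^ a" and "z \<noteq> 0"
  shows "z \<in> drinfeld_plane emb" "absv z \<le> imag_abs emb z"
proof -
  let ?K = "{emb a / emb b | a b. b \<noteq> 0}"
  have far: "absv z \<le> dist z x" if x: "x \<in> ?K" for x
  proof -
    obtain a b where ab: "x = emb a / emb b" "b \<noteq> 0" using x by blast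
    have "absv x \<noteq> absv z"
    proof (cases "a = 0")
      case True
      then show ?thesis using ab assms(2) by simp
    next
      case False
      have "0 < real CARD('f) ^ degree b" using card_ge_2[where ?'f = 'f] by (intro zero_less_power) simp
      moreover have "absv x = real CARD('f) ^ degree a / real CARD('f) ^ degree b"
        using ab False by (simp add: absv_divide absv_emb)
      ultimately show ?thesis using assms(1)[of "degree b" "degree a"] by (auto simp: field_simps)
    qed
    then consider "absv x < absv z" | "absv z < absv x" by linarith
    then show ?thesis
    proof cases
      case 1
      then have "absv (- x + z) = absv z" by (intro absv_add_eq) simp
      then show ?thesis using dist_minus[of z x] by simp
    next
      case 2
      then have "absv (z + - x) = absv (- x)" by (intro absv_add_eq) simp
      then show ?thesis using 2 dist_minus[of z x] by simp
    qed
  qed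
  have "closed {x. absv z \<le> dist z x}" by (intro closed_Collect_le continuous_intros)
  then have K: "K_infinity emb \<subseteq> {x. absv z \<le> dist z x}"
    unfolding K_infinity_def by (intro closure_minimal) (use far in auto)
  then show "z \<in> drinfeld_plane emb" using assms(2) by (auto simp: drinfeld_plane_def)
  \<comment> \<open>Nonemptiness matters, as \<open>infdist\<close> to the empty set is 0 by
    convention.\<close>
  have "emb 0 / emb 1 \<in> ?K" by (rule CollectI, rule exI[of _ 0], rule exI[of _ 1]) simp
  then have "emb 0 / emb 1 \<in> K_infinity emb" unfolding K_infinity_def by (rule subsetD[OF closure_subset])
  then have "K_infinity emb \<noteq> {}" by blast
  then show "absv z \<le> imag_abs emb z"
    using K by (auto simp: imag_abs_def infdist_def intro!: cINF_greatest)
qed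

lemma uniformiser_const_mult:
  "uniformiser emb \<pi> (emb [:c:] * z) = uniformiser emb \<pi> z / emb [:c:]"
proof -
  have "\<pi> * (emb [:c:] * z) = emb [:c:] * (\<pi> * z)" by simp
  then show ?thesis unfolding uniformiser_def by (simp only: carlitz_exp_const_mult) simp
qed

lemma uniformiser_add:
  assumes "carlitz_period emb \<pi>"
  shows "uniformiser emb \<pi> (z + emb b) = uniformiser emb \<pi> z"
proof -
  have "carlitz_exp emb (\<pi> * emb b) = 0" using assms unfolding carlitz_period_def by blast
  then show ?thesis by (simp add: uniformiser_def carlitz_exp_add distrib_left)
qed

text \<open>The points are \<open>a \<theta> ^ n sqrt \<theta>\<close>, where \<open>\<pi> a\<close> is the zero found above: their absolute values are
  not in the value group of \<open>K\<^sub>\<infinity>\<close>.\<close>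

lemma uniformiser_sequence:
  assumes period: "carlitz_period emb \<pi>"
  shows "\<exists>Z. (\<forall>n. uniformiser emb \<pi> (Z n) \<noteq> 0) \<and> (\<lambda>n. uniformiser emb \<pi> (Z n)) \<longlonglongrightarrow> 0 \<and>
    (\<forall>c\<noteq>0. \<forall>n. emb [:c:] * Z n \<in> drinfeld_plane emb \<and> real n < imag_abs emb (emb [:c:] * Z n))"
proof -
  let ?q = "CARD('f)"
  have q2: "?q \<ge> 2" by (rule card_ge_2)
  obtain z0 where z0: "carlitz_exp emb z0 = 0" "absv z0 ^ (?q - 1) = real ?q ^ ?q"
    using carlitz_exp_zero by blast
  obtain a where a: "z0 = \<pi> * emb a"
    using z0(1) period unfolding carlitz_period_def by blast
  have "z0 \<noteq> 0"
  proof
    assume "z0 = 0"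
    then have "real ?q ^ ?q = 0" using z0 q2 by (simp add: power_0_left)
    then show False using q2 by simp
  qed
  then have a0: "a \<noteq> 0" and z0_pos: "0 < absv z0" using a by auto
  \<comment> \<open>|s| is the square root of q, strictly between 1 and q, so multiples of
    \<open>s\<close> by powers of theta fall strictly between consecutive powers of q.\<close>
  obtain s where s: "s ^ 2 = emb [:0, 1:]" using nth_root_exists[of 2] by auto
  have s_abs: "absv s ^ 2 = real ?q" unfolding absv_power[symmetric] s by (rule abs_theta)
  have "1 ^ 2 < absv s ^ 2" unfolding s_abs using q2 by simp
  then have s1: "1 < absv s" by (rule power_less_imp_less_base) simp
  have "absv s < absv s ^ 2" using s1 power_strict_increasing[of 1 2 "absv s"] by simp
  then have sq: "absv s < real ?q" unfolding s_abs .
  define x where "x n = emb [:0, 1:] ^ n * s" for n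
  \<comment> \<open>The factor \<open>emb a\<close> turns \<open>\<pi> * Z n\<close> into
    \<open>z0 * x n\<close>, where \<open>carlitz_exp_large\<close> applies.\<close>
  define Z where "Z n = emb a * x n" for n
  have x_abs: "absv (x n) = real ?q ^ n * absv s" for n
    by (simp add: x_def abs_mult absv_power abs_theta)
  have Z_abs: "absv (Z n) = real ?q ^ (degree a + n) * absv s" for n
    using a0 by (simp add: Z_def abs_mult absv_emb x_abs power_add)
  have n_less: "real n < real ?q ^ n" for n
    using power_gt_expt[of ?q n] q2 by (simp flip: of_nat_power)
  have exp_large: "absv z0 * real n \<le> absv (carlitz_exp emb (\<pi> * Z n))"
    and exp_nonzero: "carlitz_exp emb (\<pi> * Z n) \<noteq> 0" for n
  proof -
    have pos: "0 < real ?q ^ n" using q2 by (intro zero_less_power) simp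
    have x: "real ?q ^ n < absv (x n)" "absv (x n) < real ?q ^ Suc n"
      unfolding x_abs using pos s1 sq by simp_all
    have "absv z0 * real n \<le> absv z0 * absv (x n)"
      using z0_pos less_trans[OF n_less x(1)] by (intro mult_left_mono) auto
    have "\<pi> * Z n = z0 * x n" by (simp add: Z_def a)
    then have large: "absv z0 * absv (x n) \<le> absv (carlitz_exp emb (\<pi> * Z n))"
      using carlitz_exp_large[OF z0(2) x] by simp
    then show "absv z0 * real n \<le> absv (carlitz_exp emb (\<pi> * Z n))"
      using \<open>absv z0 * real n \<le> absv z0 * absv (x n)\<close> by linarith
    have "0 < absv z0 * absv (x n)" using z0_pos less_trans[OF pos x(1)] by (rule mult_pos_pos)
    then show "carlitz_exp emb (\<pi> * Z n) \<noteq> 0" using large by auto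
  qed
  have "(\<lambda>n. 1 / absv z0 * inverse (real n)) \<longlonglongrightarrow> 0"
    by (intro tendsto_mult_right_zero lim_inverse_n)
  moreover have "\<forall>\<^sub>F n in sequentially. dist (uniformiser emb \<pi> (Z n)) 0 \<le> 1 / absv z0 * inverse (real n)"
    using eventually_gt_at_top[of 0]
  proof (rule eventually_mono)
    fix n :: nat assume "0 < n"
    then have "1 / absv (carlitz_exp emb (\<pi> * Z n)) \<le> 1 / (absv z0 * real n)"
      using exp_large[of n] z0_pos by (intro divide_left_mono) (auto intro!: mult_pos_pos exp_nonzero)
    then show "dist (uniformiser emb \<pi> (Z n)) 0 \<le> 1 / absv z0 * inverse (real n)"
      by (simp add: uniformiser_def absv_divide absv_inverse divide_inverse)
  qed
  ultimately have "(\<lambda>n. dist (uniformiser emb \<pi> (Z n)) 0) \<longlonglongrightarrow> 0"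
    by - (rule tendsto_sandwich[OF _ _ tendsto_const], auto)
  then have lim: "(\<lambda>n. uniformiser emb \<pi> (Z n)) \<longlonglongrightarrow> 0" by (rule tendsto_dist_iff[THEN iffD2])
  have plane: "emb [:c:] * Z n \<in> drinfeld_plane emb \<and> real n < imag_abs emb (emb [:c:] * Z n)"
    if "c \<noteq> 0" for c n
  proof -
    have cZ: "absv (emb [:c:] * Z n) = real ?q ^ (degree a + n) * absv s"
      using that by (simp add: abs_mult absv_emb_const Z_abs)
    \<comment> \<open>After squaring, an odd power of q would equal an even one.\<close>
    have not_int: "absv (emb [:c:] * Z n) * real ?q ^ i \<noteq> real ?q ^ j" for i j
    proof
      assume "absv (emb [:c:] * Z n) * real ?q ^ i = real ?q ^ j"
      then have "real ?q ^ (degree a + n + i) * absv s = real ?q ^ j"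
        unfolding cZ by (simp add: power_add mult_ac)
      then have "(real ?q ^ (degree a + n + i) * absv s) ^ 2 = (real ?q ^ j) ^ 2" by simp
      then have "real ?q ^ (2 * (degree a + n + i) + 1) = real ?q ^ (2 * j)"
        by (simp add: power_mult_distrib s_abs mult_ac flip: power_mult)
      then have "2 * (degree a + n + i) + 1 = 2 * j"
        using q2 by (subst (asm) power_inject_exp) auto
      then show False by presburger
    qed
    have "1 * 1 \<le> real ?q ^ degree a * absv s"
      using s1 q2 by (intro mult_mono one_le_power) auto
    then have "real ?q ^ n * 1 \<le> real ?q ^ n * (real ?q ^ degree a * absv s)"
      by (intro mult_left_mono) auto
    then have "real n < real ?q ^ n * (real ?q ^ degree a * absv s)"
      using n_less[of n] by linarith
    then have "real n < absv (emb [:c:] * Z n)"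
      unfolding cZ by (simp add: power_add mult_ac)
    moreover from this have "emb [:c:] * Z n \<noteq> 0" by (metis dist_self not_less of_nat_0_le_iff)
    ultimately show ?thesis
      using drinfeld_plane_imag_abs[OF not_int] by (meson less_le_trans)
  qed
  show ?thesis
    by (rule exI[of _ Z]) (use lim plane exp_nonzero in \<open>auto simp: uniformiser_def\<close>)
qed

end

section \<open>Invariance under the diagonal torus\<close>

text \<open>With r = n mod (q - 1), all q - 1 nonzero elements would be roots of X^r - 1, too many
  unless r = 0.\<close>

lemma card_minus_one_dvd:
  assumes "\<And>c :: 'f::finite_field. c \<noteq> 0 \<Longrightarrow> c ^ n = 1"
  shows "(CARD('f) - 1) dvd n"
proof (rule ccontr)
  let ?m = "CARD('f) - 1"
  assume "\<not> ?m dvd n"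
  have m: "0 < ?m" using card_ge_2[where ?'f = 'f] by simp
  define r where "r = n mod ?m"
  have r: "0 < r" "r < ?m"
    using \<open>\<not> ?m dvd n\<close> m by (auto simp: r_def dvd_eq_mod_eq_0)
  have one: "c ^ r = 1" if "c \<noteq> 0" for c :: 'f
  proof -
    have "c * c ^ ?m = c * 1"
      using finite_field_power_card_eq_same[of c] power_eq_if[of c "CARD('f)"] m by simp
    then have "c ^ ?m = 1" using that by (subst (asm) mult_left_cancel) auto
    moreover have "n = ?m * (n div ?m) + r" by (simp add: r_def)
    then have "c ^ n = (c ^ ?m) ^ (n div ?m) * c ^ r" by (metis power_add power_mult)
    ultimately show ?thesis using assms[OF that] by simp
  qed
  define p :: "'f poly" where "p = monom 1 r - 1"
  have "coeff p r = 1" using r by (simp add: p_def)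
  then have "p \<noteq> 0" by auto
  have "degree p \<le> r"
    unfolding p_def by (intro degree_diff_le) (simp_all add: degree_monom_le)
  moreover have "UNIV - {0} \<subseteq> {x. poly p x = 0}"
    using one by (auto simp: p_def poly_monom)
  then have "card (UNIV - {0 :: 'f}) \<le> card {x. poly p x = 0}"
    by (intro card_mono poly_roots_finite \<open>p \<noteq> 0\<close>)
  then have "?m \<le> degree p"
    using card_poly_roots_bound[OF \<open>p \<noteq> 0\<close>] by simp
  ultimately show False using r by simp
qed

section \<open>Cosets of H in the group of invertible matrices over A\<close>

lemma mat_mult_2:
  assumes "A \<in> carrier_mat 2 2" "B \<in> carrier_mat 2 2" "i < 2" "j < 2"
  shows "(A * B) $$ (i, j) = A $$ (i, 0) * B $$ (0, j) + A $$ (i, 1) * B $$ (1, j)"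
  using assms by (simp add: scalar_prod_def numeral_2_eq_2)

lemma GL2_carrier: "\<gamma> \<in> GL2 \<Longrightarrow> \<gamma> \<in> carrier_mat 2 2"
  by (simp add: GL2_def)

lemma GL2_inverse:
  assumes "\<gamma> \<in> GL2"
  obtains \<gamma>' where "\<gamma>' \<in> carrier_mat 2 2" "\<gamma> * \<gamma>' = 1\<^sub>m 2" "\<gamma>' * \<gamma> = 1\<^sub>m 2"
proof -
  obtain B where B: "\<gamma> * B = 1\<^sub>m (dim_row \<gamma>)" "B * \<gamma> = 1\<^sub>m (dim_row B)"
    using assms by (auto simp: GL2_def invertible_mat_def inverts_mat_def)
  have dims: "dim_row \<gamma> = 2" "dim_col \<gamma> = 2" using assms by (auto simp: GL2_def)
  \<comment> \<open>\<open>invertible_mat\<close> says nothing about the shape of the inverse; it is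
    read off from the identity matrices.\<close>
  have "dim_col (\<gamma> * B) = 2" unfolding B(1) by (simp add: dims)
  moreover have "dim_col (B * \<gamma>) = dim_row B" unfolding B(2) by simp
  ultimately have "B \<in> carrier_mat 2 2" by (auto simp: dims)
  then show thesis using B dims by (intro that[of B]) auto
qed

lemma GL2_I:
  assumes "\<gamma> \<in> carrier_mat 2 2" "\<gamma>' \<in> carrier_mat 2 2" "\<gamma> * \<gamma>' = 1\<^sub>m 2" "\<gamma>' * \<gamma> = 1\<^sub>m 2"
  shows "\<gamma> \<in> GL2"
  using assms by (auto simp: GL2_def invertible_mat_def inverts_mat_def)

lemma GL2_mult:
  assumes "\<gamma> \<in> GL2" "\<delta> \<in> GL2"
  shows "\<gamma> * \<delta> \<in> GL2"
proof -
  obtain \<gamma>' where g: "\<gamma>' \<in> carrier_mat 2 2" "\<gamma> * \<gamma>' = 1\<^sub>m 2" "\<gamma>' * \<gamma> = 1\<^sub>m 2"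
    using GL2_inverse[OF assms(1)] .
  obtain \<delta>' where d: "\<delta>' \<in> carrier_mat 2 2" "\<delta> * \<delta>' = 1\<^sub>m 2" "\<delta>' * \<delta> = 1\<^sub>m 2"
    using GL2_inverse[OF assms(2)] .
  note c = assms[THEN GL2_carrier]
  have "(\<gamma> * \<delta>) * (\<delta>' * \<gamma>') = \<gamma> * ((\<delta> * \<delta>') * \<gamma>')"
    using c g(1) d(1) by (simp add: assoc_mult_mat[of _ 2 2 _ 2 _ 2])
  also have "\<dots> = 1\<^sub>m 2" using d g by simp
  finally have 1: "(\<gamma> * \<delta>) * (\<delta>' * \<gamma>') = 1\<^sub>m 2" .
  have "(\<delta>' * \<gamma>') * (\<gamma> * \<delta>) = \<delta>' * ((\<gamma>' * \<gamma>) * \<delta>)"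
    using c g(1) d(1) by (simp add: assoc_mult_mat[of _ 2 2 _ 2 _ 2])
  also have "\<dots> = 1\<^sub>m 2" using d g c by simp
  finally have 2: "(\<delta>' * \<gamma>') * (\<gamma> * \<delta>) = 1\<^sub>m 2" .
  show ?thesis by (rule GL2_I[OF _ _ 1 2]) (use c g(1) d(1) in auto)
qed

text \<open>The determinant is a unit of A, hence a nonzero constant, and for this triangular shape
  it equals the upper left entry.\<close>

lemma GL2_H_shape:
  assumes "\<eta> \<in> GL2_H"
  obtains a where "a \<noteq> 0" "\<eta> $$ (0, 0) = [:a:]" "\<eta> $$ (1, 0) = 0" "\<eta> $$ (1, 1) = 1" "det \<eta> = [:a:]"
proof -
  have \<eta>: "\<eta> \<in> GL2" "\<eta> $$ (1, 0) = 0" "\<eta> $$ (1, 1) = 1" using assms by (auto simp: GL2_H_def)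
  note c = GL2_carrier[OF \<eta>(1)]
  obtain \<eta>' where e: "\<eta>' \<in> carrier_mat 2 2" "\<eta> * \<eta>' = 1\<^sub>m 2"
    using GL2_inverse[OF \<eta>(1)] by blast
  have "upper_triangular \<eta>"
    unfolding upper_triangular_def using c \<eta>(2) by (auto simp: less_2_cases_iff)
  then have det: "det \<eta> = \<eta> $$ (0, 0)"
    using det_upper_triangular[of \<eta> 2] c \<eta>(3) by (simp add: prod_list_diag_prod numeral_2_eq_2)
  have "det \<eta> * det \<eta>' = 1" using det_mult[OF c e(1)] e(2) by simp
  then have "det \<eta> dvd 1" by (metis dvd_triv_left)
  then obtain a where "det \<eta> = [:a:]" "a \<noteq> 0" by (auto simp: is_unit_poly_iff dvd_field_iff)
  then show thesis using that det \<eta> by auto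
qed

definition H_coset :: "'f::finite_field poly mat \<Rightarrow> 'f poly mat set" where
  "H_coset \<gamma> = (\<lambda>\<eta>. \<eta> * \<gamma>) ` GL2_H"

lemma H_cosets_eq: "H_cosets = H_coset ` GL2"
  by (auto simp: H_cosets_def H_coset_def quotient_def image_iff)

lemma one_in_GL2_H: "1\<^sub>m 2 \<in> GL2_H"
  by (auto simp: GL2_H_def intro: GL2_I[of _ "1\<^sub>m 2"])

text \<open>The diagonal matrix whose Moebius transformation is multiplication by
  \<open>c\<close>.\<close>

definition scaling_mat :: "'f::finite_field \<Rightarrow> 'f poly mat" where
  "scaling_mat c = mat 2 2 (\<lambda>(i, j). if i = j then (if i = 0 then [:c:] else 1) else 0)"

lemma scaling_mat_carrier [simp]: "scaling_mat c \<in> carrier_mat 2 2"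
  by (simp add: scaling_mat_def)

lemma scaling_mat_mult: "scaling_mat c * scaling_mat c' = scaling_mat (c * c')"
  by (rule eq_matI) (auto simp: scaling_mat_def scalar_prod_def numeral_2_eq_2 less_Suc_eq)

lemma scaling_mat_1: "scaling_mat 1 = 1\<^sub>m 2"
  by (rule eq_matI) (auto simp: scaling_mat_def one_pCons)

lemma scaling_mat_inverse:
  "c \<noteq> 0 \<Longrightarrow> scaling_mat c * scaling_mat (inverse c) = 1\<^sub>m 2"
  "c \<noteq> 0 \<Longrightarrow> scaling_mat (inverse c) * scaling_mat c = 1\<^sub>m 2"
  by (simp_all add: scaling_mat_mult scaling_mat_1)

lemma scaling_mat_GL2: "c \<noteq> 0 \<Longrightarrow> scaling_mat c \<in> GL2"
  by (rule GL2_I[OF _ _ scaling_mat_inverse]) simp_all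

lemma det_scaling_mat: "det (scaling_mat c) = [:c:]"
proof -
  have "det (scaling_mat c) = prod_list (diag_mat (scaling_mat c))"
    by (rule det_upper_triangular[of _ 2]) (auto simp: scaling_mat_def)
  then show ?thesis by (simp add: prod_list_diag_prod scaling_mat_def numeral_2_eq_2)
qed

lemma H_coset_scaling:
  assumes "\<gamma> \<in> GL2"
  shows "(\<lambda>\<gamma>. \<gamma> * scaling_mat c) ` H_coset \<gamma> = H_coset (\<gamma> * scaling_mat c)"
proof -
  have "\<eta> * \<gamma> * scaling_mat c = \<eta> * (\<gamma> * scaling_mat c)" if "\<eta> \<in> GL2_H" for \<eta>
    using that GL2_carrier[OF assms] GL2_carrier[of \<eta>]
    by (simp add: GL2_H_def assoc_mult_mat[of _ 2 2 _ 2 _ 2])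
  then show ?thesis by (auto simp: H_coset_def image_image)
qed

text \<open>Right multiplication commutes with the left action of H, and the matrix for 1/c undoes
  it.\<close>

lemma H_cosets_scaling_bij:
  assumes "c \<noteq> 0"
  shows "bij_betw (\<lambda>X. (\<lambda>\<gamma>. \<gamma> * scaling_mat c) ` X) H_cosets H_cosets"
proof -
  have maps: "(\<lambda>\<gamma>. \<gamma> * scaling_mat b) ` X \<in> H_cosets" if b: "b \<noteq> 0" and X: "X \<in> H_cosets"
    for b :: 'a and X
  proof -
    obtain \<gamma> where \<gamma>: "\<gamma> \<in> GL2" "X = H_coset \<gamma>" using X by (auto simp: H_cosets_eq)
    then show ?thesis
      using H_coset_scaling[OF \<gamma>(1), of b] GL2_mult[OF \<gamma>(1) scaling_mat_GL2[OF b]] by (simp add: H_cosets_eq)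
  qed
  have cancel: "(\<lambda>\<gamma>. \<gamma> * scaling_mat b') ` (\<lambda>\<gamma>. \<gamma> * scaling_mat b) ` X = X"
    if X: "X \<in> H_cosets" and b: "scaling_mat b * scaling_mat b' = 1\<^sub>m 2" and "b \<noteq> 0" for b b' :: 'a and X
  proof -
    obtain \<gamma> where \<gamma>: "\<gamma> \<in> GL2" "X = H_coset \<gamma>" using X by (auto simp: H_cosets_eq)
    have "\<gamma> * scaling_mat b * scaling_mat b' = \<gamma>"
      using GL2_carrier[OF \<gamma>(1)] b by (simp add: assoc_mult_mat[of _ 2 2 _ 2 _ 2])
    then show ?thesis
      unfolding \<gamma>(2) using H_coset_scaling[OF \<gamma>(1), of b]
        H_coset_scaling[OF GL2_mult[OF \<gamma>(1) scaling_mat_GL2[OF \<open>b \<noteq> 0\<close>]], of b'] by simp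
  qed
  show ?thesis
    by (rule bij_betw_byWitness[where f' = "\<lambda>X. (\<lambda>\<gamma>. \<gamma> * scaling_mat (inverse c)) ` X"])
      (use assms maps cancel scaling_mat_inverse[OF assms] in auto)
qed

section \<open>Scaling of the Eisenstein and Poincare series and the exponents in their
  expansions\<close>

context C_infinity
begin

lemma infsum_cmult_nonarch:
  fixes f :: "'b \<Rightarrow> 'c"
  assumes "k \<noteq> 0"
  shows "infsum (\<lambda>x. k * f x) A = k * infsum f A"
proof -
  have sum: "((\<lambda>x. k * f x) has_sum k * S) A" if "(f has_sum S) A" for f :: "'b \<Rightarrow> 'c" and k S
    using tendsto_cmult_nonarch[OF that[unfolded has_sum_def], of k]
    by (simp add: has_sum_def sum_distrib_left)
  show ?thesis
  proof (cases "f summable_on A")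
    case True
    then show ?thesis by (intro infsumI sum has_sum_infsum)
  next
    \<comment> \<open>A family that is not summable has \<open>infsum\<close> 0, and division by
      \<open>k\<close> shows that the scaled family is not summable either.\<close>
    case False
    have "\<not> (\<lambda>x. k * f x) summable_on A"
    proof
      assume "(\<lambda>x. k * f x) summable_on A"
      then obtain S where "((\<lambda>x. k * f x) has_sum S) A" by (auto simp: summable_on_def)
      from sum[OF this, of "inverse k"] have "(f has_sum inverse k * S) A"
        using assms by (simp flip: mult.assoc)
      then show False using False by (auto simp: summable_on_def)
    qed
    with False show ?thesis by (simp add: infsum_not_exists)
  qed
qed

text \<open>Since u(c z) = u(z) / c, comparing the expansions at c z and z gives a power series with
  coefficients f_n (c^(-n) - c^(-j)) that vanishes at the points of
  \<open>uniformiser_sequence\<close>, hence identically.\<close>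

lemma expansion_coeff_scaling:
  fixes c :: 'f
  assumes period: "carlitz_period emb \<pi>" and expansion: "is_u_expansion emb \<pi> f F"
    and F: "\<And>c z. c \<noteq> 0 \<Longrightarrow> F (emb [:c:] * z) = (1 / emb [:c:]) ^ j * F z"
    and fn: "fps_nth f n \<noteq> 0" and c: "c \<noteq> 0"
  shows "c ^ n = c ^ j"
proof -
  let ?C = "emb [:c:]" and ?u = "uniformiser emb \<pi>"
  obtain Z where Z: "\<And>n. ?u (Z n) \<noteq> 0" "(\<lambda>n. ?u (Z n)) \<longlonglongrightarrow> 0"
    "\<And>c n. c \<noteq> 0 \<Longrightarrow> emb [:c:] * Z n \<in> drinfeld_plane emb"
    "\<And>c n. c \<noteq> 0 \<Longrightarrow> real n < imag_abs emb (emb [:c:] * Z n)"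
    using uniformiser_sequence[OF period] by blast
  obtain M where M: "\<And>z. z \<in> drinfeld_plane emb \<Longrightarrow> imag_abs emb z > M \<Longrightarrow>
      (\<lambda>n. emb (fps_nth f n) * ?u z ^ n) sums F z"
    using expansion unfolding is_u_expansion_def by blast
  \<comment> \<open>Dropping the first \<open>N\<close> points leaves only points beyond the bound
    \<open>M\<close> on the imaginary part.\<close>
  obtain N :: nat where N: "M < real N" using reals_Archimedean2 by blast
  have C0: "?C \<noteq> 0" using c by (intro emb_nonzero) simp
  have sums: "(\<lambda>n. emb (fps_nth f n) * ?u (emb [:b:] * Z (i + N)) ^ n) sums F (emb [:b:] * Z (i + N))"
    if "b \<noteq> 0" for b i
    using Z(4)[OF that, of "i + N"] N by (intro M Z(3)[OF that]) linarith
  have zero: "emb (fps_nth f n) * ((1 / ?C) ^ n - (1 / ?C) ^ j) = 0" for n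
  proof (rule power_series_identity[where u = "\<lambda>i. ?u (Z (i + N))"
        and a = "\<lambda>n. emb (fps_nth f n) * ((1 / ?C) ^ n - (1 / ?C) ^ j)"])
    fix i
    have "emb [:1:] = 1" using hom_one by (simp add: one_pCons)
    then have "(\<lambda>n. emb (fps_nth f n) * ?u (Z (i + N)) ^ n) sums F (Z (i + N))"
      using sums[of 1 i] by simp
    from sums_diff_nonarch[OF sums[OF c, of i] sums_cmult_nonarch[OF this, of "(1 / ?C) ^ j"]]
    have "(\<lambda>n. emb (fps_nth f n) * ?u (?C * Z (i + N)) ^ n
        - (1 / ?C) ^ j * (emb (fps_nth f n) * ?u (Z (i + N)) ^ n)) sums 0"
      by (simp add: F[OF c])
    then show "(\<lambda>n. emb (fps_nth f n) * ((1 / ?C) ^ n - (1 / ?C) ^ j) * ?u (Z (i + N)) ^ n) sums 0"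
      by (rule back_subst[where P = "\<lambda>f. f sums 0"])
        (simp only: uniformiser_const_mult power_divide, simp add: algebra_simps)
    show "?u (Z (i + N)) \<noteq> 0" by (rule Z(1))
    show "(\<lambda>i. ?u (Z (i + N))) \<longlonglongrightarrow> 0" using Z(2) by (rule LIMSEQ_ignore_initial_segment)
  qed
  have "emb (fps_nth f n) \<noteq> 0" using fn by (rule emb_nonzero)
  with zero[of n] have "inverse (?C ^ n) = inverse (?C ^ j)"
    by (simp add: divide_inverse power_inverse)
  then have "?C ^ n = ?C ^ j" by (rule inverse_eq_imp_eq)
  then have "emb ([:c:] ^ n - [:c:] ^ j) = 0" by (simp add: hom_minus hom_power)
  then have "[:c:] ^ n - [:c:] ^ j = 0" using emb_nonzero by blast
  then show ?thesis by (simp add: poly_const_pow)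
qed

text \<open>Replacing (a, b) by (c a, b) permutes the nonzero pairs, so the sum at c z is a
  reindexing of the sum at z.\<close>

lemma normalised_eisenstein_scaling:
  fixes c :: 'f
  assumes "c \<noteq> 0"
  shows "normalised_eisenstein w emb (emb [:c:] * z) = normalised_eisenstein w emb z"
proof -
  let ?g = "\<lambda>(a, b). (Polynomial.smult c a, b :: 'f poly)"
  have bij: "bij_betw ?g (- {(0, 0)}) (- {(0, 0)})"
    by (rule bij_betw_byWitness[where f' = "\<lambda>(a, b). (Polynomial.smult (inverse c) a, b)"])
      (use assms in auto)
  have "emb (Polynomial.smult c a) = emb [:c:] * emb a" for a
    by (simp flip: hom_mult)
  then have "(\<lambda>x. (case ?g x of (a, b) \<Rightarrow> 1 / (emb a * z + emb b) ^ w))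
      = (\<lambda>(a, b). 1 / (emb a * (emb [:c:] * z) + emb b) ^ w)"
    by (auto simp: mult_ac)
  then have "eisenstein w emb (emb [:c:] * z) = eisenstein w emb z"
    unfolding eisenstein_def using infsum_reindex_bij_betw[OF bij, of "\<lambda>(a, b). 1 / (emb a * z + emb b) ^ w"] by simp
  then show ?thesis by (simp add: normalised_eisenstein_def)
qed

definition poincare_term :: "nat \<Rightarrow> nat \<Rightarrow> 'c \<Rightarrow> 'f poly mat \<Rightarrow> 'c \<Rightarrow> 'c" where
  "poincare_term w m \<pi> \<gamma> z = emb (det \<gamma>) ^ m * uniformiser emb \<pi> (moebius emb \<gamma> z) ^ m
     / (emb (\<gamma> $$ (1, 0)) * z + emb (\<gamma> $$ (1, 1))) ^ w"

text \<open>\<open>\<eta>\<close> multiplies the determinant by \<open>a\<close>, divides the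
  uniformiser by \<open>a\<close> and leaves the second row alone.\<close>

lemma poincare_term_coset:
  assumes period: "carlitz_period emb \<pi>" and "w > 0" and \<eta>: "\<eta> \<in> GL2_H" and \<gamma>: "\<gamma> \<in> GL2"
  shows "poincare_term w m \<pi> (\<eta> * \<gamma>) z = poincare_term w m \<pi> \<gamma> z"
proof -
  obtain a where a: "a \<noteq> 0" "\<eta> $$ (0, 0) = [:a:]" "\<eta> $$ (1, 0) = 0" "\<eta> $$ (1, 1) = 1" "det \<eta> = [:a:]"
    using GL2_H_shape[OF \<eta>] .
  have \<eta>c: "\<eta> \<in> carrier_mat 2 2" using \<eta> by (simp add: GL2_H_def GL2_carrier)
  note \<gamma>c = GL2_carrier[OF \<gamma>]
  let ?A = "emb [:a:]" and ?b = "\<eta> $$ (0, 1)"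
  have A0: "?A \<noteq> 0" using a(1) by (intro emb_nonzero) simp
  define den where "den = emb (\<gamma> $$ (1, 0)) * z + emb (\<gamma> $$ (1, 1))"
  have entries: "(\<eta> * \<gamma>) $$ (0, 0) = [:a:] * \<gamma> $$ (0, 0) + ?b * \<gamma> $$ (1, 0)"
    "(\<eta> * \<gamma>) $$ (0, 1) = [:a:] * \<gamma> $$ (0, 1) + ?b * \<gamma> $$ (1, 1)"
    "(\<eta> * \<gamma>) $$ (1, 0) = \<gamma> $$ (1, 0)" "(\<eta> * \<gamma>) $$ (1, 1) = \<gamma> $$ (1, 1)"
    using mat_mult_2[OF \<eta>c \<gamma>c] a by simp_all
  show ?thesis
  proof (cases "den = 0")
    \<comment> \<open>Division by \<open>0 ^ w\<close> with w > 0 makes both summands 0.\<close>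
    case True
    then show ?thesis using \<open>w > 0\<close> unfolding poincare_term_def entries by (simp add: den_def)
  next
    case False
    have "moebius emb (\<eta> * \<gamma>) z = ?A * moebius emb \<gamma> z + emb ?b"
    proof -
      have "emb ((\<eta> * \<gamma>) $$ (0, 0)) * z + emb ((\<eta> * \<gamma>) $$ (0, 1))
          = ?A * (emb (\<gamma> $$ (0, 0)) * z + emb (\<gamma> $$ (0, 1))) + emb ?b * den"
        unfolding entries den_def hom_add hom_mult by (simp only: distrib_left distrib_right mult_ac add_ac)
      moreover have "(x * y + x' * den) / den = x * (y / den) + x'" for x x' y
        using False by (simp add: add_divide_distrib)
      ultimately show ?thesis
        unfolding moebius_def entries(3,4) den_def[symmetric] by (simp only:)
    qed
    then have "uniformiser emb \<pi> (moebius emb (\<eta> * \<gamma>) z) = uniformiser emb \<pi> (moebius emb \<gamma> z) / ?A"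
      by (simp add: uniformiser_add[OF period] uniformiser_const_mult)
    moreover have "emb (det (\<eta> * \<gamma>)) = ?A * emb (det \<gamma>)"
      unfolding det_mult[OF \<eta>c \<gamma>c] a(5) hom_mult ..
    ultimately show ?thesis
      unfolding poincare_term_def entries(3,4) using A0 by (simp add: power_mult_distrib power_divide)
  qed
qed

text \<open>Scaling z is absorbed into \<open>\<gamma>\<close> by right multiplication; the
  determinant then carries an extra factor c, which (1/c)^m compensates.\<close>

lemma poincare_term_scaling:
  fixes c :: 'f
  assumes c: "c \<noteq> 0" and \<gamma>: "\<gamma> \<in> GL2"
  shows "poincare_term w m \<pi> \<gamma> (emb [:c:] * z)
    = (1 / emb [:c:]) ^ m * poincare_term w m \<pi> (\<gamma> * scaling_mat c) z"
proof -
  note \<gamma>c = GL2_carrier[OF \<gamma>]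
  have C0: "emb [:c:] \<noteq> 0" using c by (intro emb_nonzero) simp
  have row: "(\<gamma> * scaling_mat c) $$ (i, 0) = \<gamma> $$ (i, 0) * [:c:]"
    "(\<gamma> * scaling_mat c) $$ (i, 1) = \<gamma> $$ (i, 1)" if "i < 2" for i
    using mat_mult_2[OF \<gamma>c scaling_mat_carrier that, of _ c] that by (simp_all add: scaling_mat_def)
  have entries: "(\<gamma> * scaling_mat c) $$ (0, 0) = \<gamma> $$ (0, 0) * [:c:]"
    "(\<gamma> * scaling_mat c) $$ (0, 1) = \<gamma> $$ (0, 1)"
    "(\<gamma> * scaling_mat c) $$ (1, 0) = \<gamma> $$ (1, 0) * [:c:]"
    "(\<gamma> * scaling_mat c) $$ (1, 1) = \<gamma> $$ (1, 1)"
    by (rule row, simp)+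
  have "moebius emb (\<gamma> * scaling_mat c) z = moebius emb \<gamma> (emb [:c:] * z)"
    unfolding moebius_def entries hom_mult by (simp only: mult.assoc)
  moreover have "emb (det (\<gamma> * scaling_mat c)) = emb (det \<gamma>) * emb [:c:]"
    unfolding det_mult[OF \<gamma>c scaling_mat_carrier] det_scaling_mat hom_mult ..
  moreover have "emb ((\<gamma> * scaling_mat c) $$ (1, 0)) * z + emb ((\<gamma> * scaling_mat c) $$ (1, 1))
      = emb (\<gamma> $$ (1, 0)) * (emb [:c:] * z) + emb (\<gamma> $$ (1, 1))"
    unfolding entries hom_mult by (simp only: mult.assoc)
  ultimately show ?thesis
    unfolding poincare_term_def using C0 by (simp add: power_mult_distrib power_divide)
qed

text \<open>By \<open>poincare_term_coset\<close> the chosen representatives may be replaced by any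
  others; scaling then permutes the cosets up to the common factor.\<close>

lemma poincare_scaling:
  fixes c :: 'f
  assumes period: "carlitz_period emb \<pi>" and "w > 0" and c: "c \<noteq> 0"
  shows "poincare w m emb \<pi> (emb [:c:] * z) = (1 / emb [:c:]) ^ m * poincare w m emb \<pi> z"
proof -
  define T where "T X z = poincare_term w m \<pi> (SOME \<gamma>. \<gamma> \<in> X) z" for X z
  have T_coset: "T (H_coset \<gamma>) z = poincare_term w m \<pi> \<gamma> z" if \<gamma>: "\<gamma> \<in> GL2" for \<gamma> z
  proof -
    have "(SOME \<gamma>'. \<gamma>' \<in> H_coset \<gamma>) \<in> H_coset \<gamma>"
      by (rule someI_ex) (use one_in_GL2_H in \<open>auto simp: H_coset_def\<close>)
    then obtain \<eta> where "\<eta> \<in> GL2_H" "(SOME \<gamma>'. \<gamma>' \<in> H_coset \<gamma>) = \<eta> * \<gamma>"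
      by (auto simp: H_coset_def)
    then show ?thesis using poincare_term_coset[OF period \<open>w > 0\<close> _ \<gamma>] by (simp add: T_def)
  qed
  have C0: "(1 / emb [:c:]) ^ m \<noteq> 0" using c emb_nonzero[of "[:c:]"] by simp
  have P: "poincare w m emb \<pi> z = infsum (\<lambda>X. T X z) H_cosets" for z
    by (simp add: poincare_def T_def poincare_term_def Let_def)
  have "T X (emb [:c:] * z) = (1 / emb [:c:]) ^ m * T ((\<lambda>\<gamma>. \<gamma> * scaling_mat c) ` X) z"
    if X: "X \<in> H_cosets" for X
  proof -
    obtain \<gamma> where \<gamma>: "\<gamma> \<in> GL2" "X = H_coset \<gamma>" using X by (auto simp: H_cosets_eq)
    then show ?thesis
      using c by (simp add: T_coset H_coset_scaling GL2_mult scaling_mat_GL2 poincare_term_scaling)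
  qed
  then have "poincare w m emb \<pi> (emb [:c:] * z)
      = infsum (\<lambda>X. (1 / emb [:c:]) ^ m * T ((\<lambda>\<gamma>. \<gamma> * scaling_mat c) ` X) z) H_cosets"
    unfolding P by (rule infsum_cong)
  also have "\<dots> = (1 / emb [:c:]) ^ m * infsum (\<lambda>X. T ((\<lambda>\<gamma>. \<gamma> * scaling_mat c) ` X) z) H_cosets"
    by (rule infsum_cmult_nonarch[OF C0])
  also have "infsum (\<lambda>X. T ((\<lambda>\<gamma>. \<gamma> * scaling_mat c) ` X) z) H_cosets = poincare w m emb \<pi> z"
    unfolding P by (rule infsum_reindex_bij_betw[OF H_cosets_scaling_bij[OF c]])
  finally show ?thesis .
qed

lemma sparse_eisenstein_expansion:
  assumes "carlitz_period emb \<pi>" "is_u_expansion emb \<pi> g (normalised_eisenstein w emb)"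
  shows "sparse (CARD('f) - 1) g"
proof -
  have "(CARD('f) - 1) dvd n" if "fps_nth g n \<noteq> 0" for n
    using expansion_coeff_scaling[OF assms, of 0 n] normalised_eisenstein_scaling that
    by (intro card_minus_one_dvd) simp
  then show ?thesis by (auto simp: sparse_def)
qed

text \<open>The exponents of \<open>h\<close> are congruent to 1 modulo q - 1, so h = u h' with
  \<open>h'\<close> a series in u^(q-1), and both u^(q-1) and h'^(q-1) are such series.\<close>

lemma sparse_Delta_poincare_expansion:
  assumes "carlitz_period emb \<pi>" "is_u_expansion emb \<pi> h (poincare w 1 emb \<pi>)" "w > 0"
    and h0: "fps_nth h 0 = 0"
  shows "sparse (CARD('f) - 1) (Delta h)"
proof -
  define h' where "h' = Abs_fps (\<lambda>n. fps_nth h (Suc n))"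
  have h: "h = fps_X * h'"
    by (rule fps_ext) (use h0 in \<open>auto simp: h'_def split: nat.splits\<close>)
  have "(CARD('f) - 1) dvd n" if "fps_nth h' n \<noteq> 0" for n
  proof (rule card_minus_one_dvd)
    fix c :: 'f assume "c \<noteq> 0"
    have "c ^ Suc n = c ^ 1"
      by (rule expansion_coeff_scaling[OF assms(1,2) poincare_scaling[OF assms(1,3)]])
        (use that \<open>c \<noteq> 0\<close> in \<open>simp_all add: h'_def\<close>)
    then show "c ^ n = 1" using \<open>c \<noteq> 0\<close> by simp
  qed
  then have h': "sparse (CARD('f) - 1) h'" by (auto simp: sparse_def)
  have X: "sparse (CARD('f) - 1) (fps_X ^ (CARD('f) - 1) :: 'f poly fps)"
    by (auto simp: sparse_def)
  show ?thesis
    unfolding Delta_def h power_mult_distrib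
    by (rule sparse_uminus[OF sparse_mult[OF X sparse_power[OF h']]])
qed

end

section \<open>The determinant for the Drinfeld modular forms\<close>

theorem theorem2:
  fixes emb :: "'f::finite_field poly \<Rightarrow> 'c::{alg_closed_field, complete_space}"
    and \<pi> :: 'c
    and g h :: "'f poly fps"
    and d :: "'f poly poly fps"
    and q k :: nat
  assumes "q = CARD('f)"
    and "C_infinity emb"
    and "carlitz_period emb \<pi>"
    and g_expansion: "is_u_expansion emb \<pi> g (normalised_eisenstein (q - 1) emb)"
    and g_leading: "fps_nth g 0 = 1" "\<And>n. 0 < n \<Longrightarrow> n < q - 1 \<Longrightarrow> fps_nth g n = 0"
      "fps_nth g (q - 1) = - ([:0, 1:] ^ q - [:0, 1:])"
    and h_expansion: "is_u_expansion emb \<pi> h (poincare (q + 1) 1 emb \<pi>)"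
    and h_leading: "fps_nth h 0 = 0" "fps_nth h 1 = - 1"
    and d_equation:
      "fps_const (t_var - theta ^ q) * lift_series (Delta h) * tau (tau d)
         + lift_series g * tau d - d = 0"
    and d_constant: "fps_nth d 0 = 1"
    and "k \<ge> 1"
  shows "H_det k d \<noteq> 0 \<and>
    (let \<nu> = subdegree (H_det k d); \<kappa> = fps_nth (H_det k d) \<nu> in
       (of_nat \<nu> :: rat)
         = (of_nat q ^ k - 1) * (of_nat q ^ (k - 1) - 1) / (of_nat q ^ 2 - 1)
       \<and> \<kappa> = B_poly k
       \<and> (\<exists>F. H_det k d = fps_const \<kappa> * F
            \<and> F \<in> range (\<lambda>G. fps_compose G (fps_X ^ (q - 1)))
            \<and> fps_nth F (subdegree F) = 1))"
proof -
  interpret C_infinity emb by fact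
  interpret tau_equation q g h d
    by unfold_locales (use assms in simp_all)
  have "sparse (q - 1) g"
    using sparse_eisenstein_expansion[OF \<open>carlitz_period emb \<pi>\<close> g_expansion] \<open>q = CARD('f)\<close> by simp
  moreover have "sparse (q - 1) (Delta h)"
    using sparse_Delta_poincare_expansion[OF \<open>carlitz_period emb \<pi>\<close> h_expansion _ h_leading(1)] \<open>q = CARD('f)\<close> by simp
  ultimately show ?thesis
    using H_det_properties[OF _ _ \<open>k \<ge> 1\<close>] by (simp add: Let_def)
qed

end
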